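(* Let $d\ge 3$. For Lebesgue-almost every pair $(P,\lambda)\in\mathcal{P}_d\times(0,1)$, the outer billiard map $T_{P,\lambda}$ of $P$ with contraction $\lambda$ is asymptotically periodic.
   Context: Outer billiards with contraction. Let $d\ge 3$. A convex $d$-gon is a compact convex polygon $P\subset\mathbb{C}$ (with non-empty interior) having exactly $d$ cyclically ordered vertices $\boldsymbol{v}=(v_1,\dots,v_d)$. The set $\mathcal{P}_d$ of convex $d$-gons is identified, via $P\leftrightarrow\boldsymbol v$, with a subset of $\mathbb{C}^d$, from which it inherits the Euclidean topology and Lebesgue measure. Put $X=\mathbb{C}\setminus P$. For $z\in X$, let $L_z$ be the supporting line of $P$ through $z$ such that, when $L_z$ is oriented from $z$ towards $P$, the interior of $P$ lies on the left of $L_z$. The singular set $\mathcal{S}_P$ is the set of $z\in X$ such that $L_z$ contains an edge of $P$ (a union of $d$ half-lines). For $z\in X\setminus\mathcal{S}_P$ the intersection $L_z\cap P$ is a single vertex; $A_k$ denotes the set of $z\in X\setminus \mathcal{S}_P$ with $L_z\cap P=\{v_k\}$. The sets $A_1,\dots,A_d$ are pairwise disjoint open cones with union $X\setminus\mathcal{S}_P$. For $\lambda\in(0,1)$ the outer billiard map of $P$ with contraction $\lambda$ is $T_{P,\lambda}:X\setminus\mathcal{S}_P\to X$, $T_{P,\lambda}(z)=-\lambda z+(1+\lambda)v_k$ for $z\in A_k$. A point $z\in X$ is non-singular if $T_{P,\lambda}^n(z)\notin\mathcal{S}_P$ for every $n\ge 0$; for such $z$, $\omega(z)$ denotes the $\omega$-limit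 set of its $T_{P,\lambda}$-orbit. $T_{P,\lambda}$ is asymptotically periodic if it has only finitely many periodic orbits and $\omega(z)$ is a periodic orbit for every non-singular point $z$. *)

theory Defs
  imports "HOL-Analysis.Analysis"
begin

text \<open>
  The tuple \<open>(v\<^sub>1, \<dots>, v\<^sub>d)\<close> is represented by an extensional function on \<open>{..<d}\<close>
  (so indices start at 0), and \<open>\<complex>\<^sup>d\<close> by the finite product measure below. Its
  \<open>\<sigma>\<close>-algebra is the Borel one; passing to the completion does not change which properties
  hold almost everywhere.
\<close>

definition tuple_measure :: "nat \<Rightarrow> (nat \<Rightarrow> complex) measure" where
  "tuple_measure d = (\<Pi>\<^sub>M k\<in>{..<d}. (lborel :: complex measure))"

definition convex_gon :: "nat \<Rightarrow> complex set \<Rightarrow> bool" where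
  "convex_gon d P \<longleftrightarrow>
     polytope P \<and> interior P \<noteq> {} \<and> card {x. x extreme_point_of P} = d"

definition polygon :: "nat \<Rightarrow> (nat \<Rightarrow> complex) \<Rightarrow> complex set" where
  "polygon d v = convex hull (v ` {..<d})"

text \<open>
  Neither the initial vertex nor the orientation of the cyclic order is fixed: every labelling
  in which consecutive vertices span edges is admitted.
\<close>

definition convex_gons :: "nat \<Rightarrow> (nat \<Rightarrow> complex) set" where
  "convex_gons d = {v \<in> {..<d} \<rightarrow>\<^sub>E UNIV.
     convex_gon d (polygon d v) \<and>
     bij_betw v {..<d} {x. x extreme_point_of polygon d v} \<and>
     (\<forall>k<d. closed_segment (v k) (v (Suc k mod d)) edge_of polygon d v)}"

definition supporting_line :: "complex set \<Rightarrow> complex set \<Rightarrow> bool" where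
  "supporting_line P L \<longleftrightarrow>
     affine L \<and> aff_dim L = 1 \<and> L \<inter> P \<noteq> {} \<and> L \<inter> interior P = {}"

text \<open>\<open>x\<close> lies strictly to the left of the line through \<open>z\<close> and \<open>w\<close>, oriented from \<open>z\<close> to \<open>w\<close>.\<close>

definition left_of :: "complex \<Rightarrow> complex \<Rightarrow> complex \<Rightarrow> bool" where
  "left_of z w x \<longleftrightarrow> Im (cnj (w - z) * (x - z)) > 0"

text \<open>The line \<open>L\<^sub>z\<close>; it is uniquely determined for \<open>z\<close> outside a convex polygon.\<close>

definition tangent_line :: "complex set \<Rightarrow> complex \<Rightarrow> complex set" where
  "tangent_line P z = (THE L. supporting_line P L \<and> z \<in> L \<and>
     (\<forall>w\<in>L \<inter> P. \<forall>x\<in>interior P. left_of z w x))"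

definition singular_set :: "complex set \<Rightarrow> complex set" where
  "singular_set P = {z. z \<notin> P \<and> (\<exists>e. e edge_of P \<and> e \<subseteq> tangent_line P z)}"

definition vertex_cone :: "nat \<Rightarrow> (nat \<Rightarrow> complex) \<Rightarrow> nat \<Rightarrow> complex set" where
  "vertex_cone d v k = {z. z \<notin> polygon d v \<and> z \<notin> singular_set (polygon d v) \<and>
     tangent_line (polygon d v) z \<inter> polygon d v = {v k}}"

text \<open>Only the values at points outside the polygon and the singular set are meaningful.\<close>

definition outer_billiard :: "nat \<Rightarrow> (nat \<Rightarrow> complex) \<Rightarrow> real \<Rightarrow> complex \<Rightarrow> complex" where
  "outer_billiard d v l z =
     - of_real l * z + (1 + of_real l) * v (THE k. k < d \<and> z \<in> vertex_cone d v k)"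

definition non_singular :: "nat \<Rightarrow> (nat \<Rightarrow> complex) \<Rightarrow> real \<Rightarrow> complex \<Rightarrow> bool" where
  "non_singular d v l z \<longleftrightarrow> z \<notin> polygon d v \<and>
     (\<forall>n. (outer_billiard d v l ^^ n) z \<notin> singular_set (polygon d v))"

definition orbit :: "(complex \<Rightarrow> complex) \<Rightarrow> complex \<Rightarrow> complex set" where
  "orbit f z = range (\<lambda>n. (f ^^ n) z)"

text \<open>Limit points are taken in \<open>\<complex>\<close>, not only in the complement of the polygon.\<close>

definition omega_limit :: "(complex \<Rightarrow> complex) \<Rightarrow> complex \<Rightarrow> complex set" where
  "omega_limit f z = (\<Inter>n. closure {(f ^^ m) z | m. m \<ge> n})"

definition periodic_orbits :: "nat \<Rightarrow> (nat \<Rightarrow> complex) \<Rightarrow> real \<Rightarrow> complex set set" where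
  "periodic_orbits d v l = {orbit (outer_billiard d v l) z | z.
     non_singular d v l z \<and> (\<exists>p>0. (outer_billiard d v l ^^ p) z = z)}"

definition asymptotically_periodic :: "nat \<Rightarrow> (nat \<Rightarrow> complex) \<Rightarrow> real \<Rightarrow> bool" where
  "asymptotically_periodic d v l \<longleftrightarrow>
     finite (periodic_orbits d v l) \<and>
     (\<forall>z. non_singular d v l z \<longrightarrow>
        omega_limit (outer_billiard d v l) z \<in> periodic_orbits d v l)"

end

theory Submission imports Defs "HOL-Complex_Analysis.Complex_Analysis" begin

text \<open>
  The conclusion holds for every convex polygon and almost every \<open>\<lambda>\<close>. Since all branches are
  homotheties of ratio \<open>-\<lambda>\<close>, the image of a large disc under the branch of a word \<open>w\<close> of length
  \<open>n\<close> has radius of order \<open>\<lambda>\<^sup>n\<close>. If for some \<open>n\<close> none of these images meets an edge line, the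
  last \<open>n\<close> letters of an itinerary determine the next one, and every orbit is attracted by one of
  finitely many periodic orbits.

  For a given word and edge, the image meets the edge line only if a power series in \<open>\<lambda>\<close> with
  coefficients from a fixed finite set has modulus of order at most \<open>\<lambda>\<^sup>n\<close>; this is a set of measure
  \<open>O(\<lambda>\<^bsup>n/K\<^esup>)\<close>, where \<open>K\<close> is uniform by compactness of the space of coefficient sequences.
  It remains to see that the number of words occurring for parameters near \<open>\<lambda>\<^sub>0\<close> has arbitrarily
  small exponential growth rate. Unless \<open>\<lambda>\<^sub>0\<close> lies in a countable set, an orbit meets each of the
  \<open>d\<close> singular rays at most once (returns to an edge line force a nontrivial polynomial relation for
  \<open>\<lambda>\<^sub>0\<close>), so that at most \<open>2\<^sup>d\<close> words of length \<open>m\<close> are possible near any point, for every \<open>m\<close>.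
\<close>

section \<open>Cones and itineraries\<close>

text \<open>Compactness gives a uniform order of vanishing only if limits of coefficient sequences
  stay nonzero. The coefficient of a letter vanishes exactly when the letter is \<open>a\<close> or
  \<open>nx a\<close>, an end of the edge considered; but a bounded orbit cannot use these two
  letters alone for \<open>J\<close> steps, so one of the first \<open>J\<close> coefficients is
  bounded away from 0. For the same reason returns along words in \<open>a\<close> and
  \<open>nx a\<close> impose no condition on the parameter, and they have to be excluded
  geometrically. The order of choices reconciles the number of words with \<open>K\<close>: the
  polygon and the parameter determine \<open>K\<close>, and only then is the block length chosen as
  \<open>m = s * Suc K\<close>. A block multiplies the number of words by at most
  \<open>2 ^ d\<close> and the length of the covering intervals by \<open>b ^ s\<close>, where
  \<open>2 ^ d * b ^ s\<close> is at most 1/2. Words are counted with closed cones, because absence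
  of a word is then stable under small changes of point and parameter. Measurability is proved for
  \<open>separated\<close>, a countable combination of polynomial inequalities with bounds rational
  in the parameter, which implies asymptotic periodicity.\<close>

definition cross :: "complex \<Rightarrow> complex \<Rightarrow> real" where
  "cross a b = Im (cnj a * b)"

definition nxt :: "nat \<Rightarrow> nat \<Rightarrow> nat" where
  "nxt d k = Suc k mod d"

definition prv :: "nat \<Rightarrow> nat \<Rightarrow> nat" where
  "prv d k = (k + d - 1) mod d"

definition side :: "nat \<Rightarrow> (nat \<Rightarrow> complex) \<Rightarrow> nat \<Rightarrow> complex \<Rightarrow> real" where
  "side d u k z = cross (u (nxt d k) - u k) (z - u k)"

definition vertex_norm :: "nat \<Rightarrow> (nat \<Rightarrow> complex) \<Rightarrow> real" where
  "vertex_norm d u = (\<Sum>k<d. cmod (u k))"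

definition ccw :: "nat \<Rightarrow> (nat \<Rightarrow> complex) \<Rightarrow> bool" where
  "ccw d u \<longleftrightarrow> (\<forall>k<d. \<forall>m<d. m \<noteq> k \<longrightarrow> m \<noteq> nxt d k \<longrightarrow> side d u k (u m) > 0)"

text \<open>
  The set \<open>A\<^sub>k\<close>, for counterclockwise vertices \<open>u\<close>: seen from \<open>z\<close>, the edge ending at \<open>u k\<close> faces
  \<open>z\<close> and the edge starting there does not.
\<close>

definition open_cone :: "nat \<Rightarrow> (nat \<Rightarrow> complex) \<Rightarrow> nat \<Rightarrow> complex set" where
  "open_cone d u k = {z. side d u k z > 0 \<and> side d u (prv d k) z < 0}"

definition closed_cone :: "nat \<Rightarrow> (nat \<Rightarrow> complex) \<Rightarrow> nat \<Rightarrow> complex set" where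
  "closed_cone d u k = {z. side d u k z \<ge> 0 \<and> side d u (prv d k) z \<le> 0}"

definition step :: "real \<Rightarrow> complex \<Rightarrow> complex \<Rightarrow> complex" where
  "step l p z = - of_real l * z + (1 + of_real l) * p"

fun walk :: "(nat \<Rightarrow> complex) \<Rightarrow> real \<Rightarrow> nat list \<Rightarrow> complex \<Rightarrow> complex" where
  "walk u l [] z = z"
| "walk u l (k # w) z = walk u l w (step l (u k) z)"

fun open_itinerary :: "nat \<Rightarrow> (nat \<Rightarrow> complex) \<Rightarrow> real \<Rightarrow> nat list \<Rightarrow> complex \<Rightarrow> bool" where
  "open_itinerary d u l [] z \<longleftrightarrow> True"
| "open_itinerary d u l (k # w) z \<longleftrightarrow> z \<in> open_cone d u k \<and> open_itinerary d u l w (step l (u k) z)"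

text \<open>The apex \<open>u k\<close> lies in its closed cone and is fixed by the step about it,
  so closed conditions alone would admit repeated letters. Genuine orbits never repeat a letter at
  once; the clause \<open>hd w \<noteq> k\<close> records this and, as it concerns only the word,
  leaves the condition closed in the point.\<close>

fun closed_itinerary :: "nat \<Rightarrow> (nat \<Rightarrow> complex) \<Rightarrow> real \<Rightarrow> nat list \<Rightarrow> complex \<Rightarrow> bool" where
  "closed_itinerary d u l [] z \<longleftrightarrow> True"
| "closed_itinerary d u l (k # w) z \<longleftrightarrow>
     z \<in> closed_cone d u k \<and> (w \<noteq> [] \<longrightarrow> hd w \<noteq> k) \<and> closed_itinerary d u l w (step l (u k) z)"

text \<open>
  The coefficients are listed from the last letter of the word backwards, since the last letter
  is the one that is not multiplied by a power of \<open>l\<close>.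
\<close>

definition word_coeff :: "nat \<Rightarrow> (nat \<Rightarrow> complex) \<Rightarrow> nat \<Rightarrow> nat list \<Rightarrow> nat \<Rightarrow> real" where
  "word_coeff d u a w j = (if j < length w then (-1) ^ j * side d u a (u (rev w ! j)) else 0)"

definition word_sum :: "nat \<Rightarrow> (nat \<Rightarrow> complex) \<Rightarrow> nat \<Rightarrow> nat list \<Rightarrow> real \<Rightarrow> real" where
  "word_sum d u a w l = (\<Sum>j<length w. word_coeff d u a w j * l ^ j)"

lemma walk_append: "walk u l (w @ x) z = walk u l x (walk u l w z)"
  by (induction w arbitrary: z) auto

lemma open_itinerary_append:
  "open_itinerary d u l (w @ x) z \<longleftrightarrow> open_itinerary d u l w z \<and> open_itinerary d u l x (walk u l w z)"
  by (induction w arbitrary: z) auto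

lemma closed_itinerary_appendD:
  assumes "closed_itinerary d u l (w @ x) z"
  shows "closed_itinerary d u l w z" "closed_itinerary d u l x (walk u l w z)"
  using assms by (induction w arbitrary: z) auto

lemma cross_simps:
  "cross a b = Re a * Im b - Im a * Re b"
  by (simp add: cross_def)

lemma cross_collinear:
  assumes "cross a b = 0" "a \<noteq> 0"
  obtains s where "b = of_real s * a"
proof -
  have "Im (cnj a * b) = 0" using assms by (simp add: cross_def)
  then have "cnj a * b = of_real (Re (cnj a * b))" by (simp add: complex_eq_iff)
  then have "b * (cnj a * a) = of_real (Re (cnj a * b)) * a" by (metis mult.assoc mult.commute)
  moreover have "cnj a * a = of_real ((cmod a)\<^sup>2)" by (metis complex_norm_square mult.commute)
  ultimately have "b * of_real ((cmod a)\<^sup>2) = of_real (Re (cnj a * b)) * a" by metis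
  then have "b = of_real (Re (cnj a * b) / (cmod a)\<^sup>2) * a"
    using assms(2) by (simp add: eq_divide_eq)
  then show ?thesis by (rule that)
qed

lemma side_step: "side d u a (step l p z) = - l * side d u a z + (1 + l) * side d u a p"
  by (simp add: side_def cross_simps step_def algebra_simps)

lemma word_sum_snoc: "word_sum d u a (w @ [k]) l = side d u a (u k) - l * word_sum d u a w l"
proof -
  have "word_sum d u a (w @ [k]) l =
      (\<Sum>j<Suc (length w). word_coeff d u a (w @ [k]) j * l ^ j)"
    by (simp add: word_sum_def)
  also have "\<dots> = side d u a (u k) + (\<Sum>j<length w. word_coeff d u a (w @ [k]) (Suc j) * l ^ Suc j)"
    by (subst sum.lessThan_Suc_shift) (simp add: word_coeff_def)
  also have "(\<Sum>j<length w. word_coeff d u a (w @ [k]) (Suc j) * l ^ Suc j)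
      = (\<Sum>j<length w. - l * (word_coeff d u a w j * l ^ j))"
    by (intro sum.cong) (auto simp: word_coeff_def)
  finally show ?thesis
    by (simp add: word_sum_def sum_distrib_left sum_negf)
qed

text \<open>The starting point enters only through a term with factor
  \<open>(- l) ^ length w\<close>. Hence a word whose image of a disc meets an edge line has small
  \<open>word_sum\<close>, and a return from an edge line to itself makes \<open>word_sum\<close>
  vanish.\<close>

lemma side_walk:
  "side d u a (walk u l w z) = (- l) ^ length w * side d u a z + (1 + l) * word_sum d u a w l"
proof (induction w rule: rev_induct)
  case Nil
  then show ?case by (simp add: word_sum_def)
next
  case (snoc k w)
  then show ?case
    by (simp add: walk_append side_step word_sum_snoc algebra_simps)
qed

section \<open>Convex polygons and their closed cones\<close>

locale cyclic_index =
  fixes d :: nat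
  assumes d3: "d \<ge> 3"
begin

abbreviation "nx \<equiv> nxt d"
abbreviation "pv \<equiv> prv d"

lemma nx_lt [simp]: "nx k < d" and pv_lt [simp]: "pv k < d"
  using d3 by (auto simp: nxt_def prv_def)

lemma nx_pv [simp]: assumes "k < d" shows "nx (pv k) = k"
proof (cases k)
  case 0
  then show ?thesis using d3 by (simp add: nxt_def prv_def)
next
  case (Suc j)
  then have "pv k = j" using assms by (simp add: prv_def)
  then show ?thesis using Suc assms by (simp add: nxt_def)
qed

lemma pv_nx [simp]: "k < d \<Longrightarrow> pv (nx k) = k"
  using d3 by (cases "Suc k = d") (auto simp: nxt_def prv_def)

lemma nx_neq [simp]: "k < d \<Longrightarrow> nx k \<noteq> k" "k < d \<Longrightarrow> k \<noteq> nx k"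
  using d3 by (cases "Suc k = d"; auto simp: nxt_def)+

lemma nx_nx_neq [simp]: "k < d \<Longrightarrow> nx (nx k) \<noteq> k" "k < d \<Longrightarrow> k \<noteq> nx (nx k)"
  using d3 by (cases "Suc k = d"; cases "Suc (Suc k) = d"; auto simp: nxt_def)+

lemma pv_neq [simp]: "k < d \<Longrightarrow> pv k \<noteq> k" "k < d \<Longrightarrow> k \<noteq> pv k"
  by (metis nx_neq nx_pv pv_lt)+

lemma pv_neq_nx [simp]: "k < d \<Longrightarrow> pv k \<noteq> nx k" "k < d \<Longrightarrow> nx k \<noteq> pv k"
  by (metis nx_nx_neq nx_pv)+

end

locale ccw_polygon = cyclic_index +
  fixes u :: "nat \<Rightarrow> complex"
  assumes ccw: "ccw d u"
begin

abbreviation "h \<equiv> side d u"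
abbreviation "V \<equiv> vertex_norm d u"
abbreviation "CC \<equiv> closed_cone d u"
abbreviation "OC \<equiv> open_cone d u"

lemma h_vertex [simp]: "h k (u k) = 0" "h k (u (nx k)) = 0"
  by (auto simp: side_def cross_simps)

lemma h_pv_vertex [simp]: "k < d \<Longrightarrow> h (pv k) (u k) = 0"
  using h_vertex(2)[of "pv k"] by simp

lemma h_pos: "\<lbrakk>k < d; m < d; m \<noteq> k; m \<noteq> nx k\<rbrakk> \<Longrightarrow> h k (u m) > 0"
  using ccw by (auto simp: ccw_def)

lemma h_nonneg: "\<lbrakk>k < d; m < d\<rbrakk> \<Longrightarrow> h k (u m) \<ge> 0"
  using h_pos[of k m] by (cases "m = k"; cases "m = nx k"; auto)

lemma corner_pos: "a < d \<Longrightarrow> h (pv a) (u (nx a)) > 0"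
  by (rule h_pos) auto

text \<open>The three-term Pluecker relation for the two edge vectors at \<open>u a\<close> and the
  vectors from \<open>u a\<close> to \<open>x\<close> and \<open>y\<close>. It converts the signs of
  the two edge functions at \<open>u a\<close> into the position of \<open>x\<close> relative to the
  line from \<open>y\<close> through \<open>u a\<close>.\<close>

lemma pluecker:
  assumes "a < d"
  shows "h (pv a) (u (nx a)) * cross (u a - y) (x - u a) = h a y * h (pv a) x - h (pv a) y * h a x"
  using assms by (simp add: side_def cross_simps algebra_simps)

text \<open>The two edge functions at \<open>u a\<close> have opposite weak signs at
  \<open>y\<close> and are nonnegative at vertices, so both terms of \<open>pluecker\<close> are
  nonnegative. Thus the line from \<open>y\<close> through \<open>u a\<close> supports the
  polygon.\<close>

lemma closed_cone_tangent:
  assumes a: "a < d" and y: "y \<in> CC a" and m: "m < d"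
  shows "cross (u a - y) (u m - u a) \<ge> 0"
proof -
  have "h (pv a) (u (nx a)) * cross (u a - y) (u m - u a) \<ge> 0"
    unfolding pluecker[OF a] using y h_nonneg[OF a m] h_nonneg[OF pv_lt m, of a]
    by (auto simp: closed_cone_def intro!: mult_nonpos_nonneg add_nonneg_nonneg diff_ge_0_iff_ge[THEN iffD2] order_trans[OF mult_nonpos_nonneg mult_nonneg_nonneg])
  then show ?thesis
    using corner_pos[OF a] by (simp add: zero_le_mult_iff)
qed

lemma both_zero_imp_vertex:
  assumes a: "a < d" and "h a y = 0" "h (pv a) y = 0"
  shows "y = u a"
proof -
  define e where "e = y - u a"
  define p where "p = u (nx a) - u a"
  define q where "q = u a - u (pv a)"
  have 1: "Re p * Im e = Im p * Re e"
    using assms by (simp add: side_def cross_simps e_def p_def)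
  have 2: "Re q * Im e = Im q * Re e"
    using assms by (simp add: side_def cross_simps e_def q_def algebra_simps)
  have 3: "Re q * Im p - Im q * Re p > 0"
    using corner_pos[OF a] a by (simp add: side_def cross_simps q_def p_def algebra_simps)
  have "(Re q * Im p - Im q * Re p) * Re e = 0" "(Re q * Im p - Im q * Re p) * Im e = 0"
    using 1 2 by algebra+
  then have "Re e = 0" "Im e = 0" using 3 by auto
  then have "e = 0" by (simp add: complex_eq_iff)
  then show ?thesis by (simp add: e_def)
qed

lemma vertex_inj: "\<lbrakk>a < d; b < d; u a = u b\<rbrakk> \<Longrightarrow> a = b"
proof (rule ccontr)
  assume ab: "a < d" "b < d" "u a = u b" "a \<noteq> b"
  show False
  proof (cases "b = nx a")
    case True
    have "h (pv a) (u b) > 0" using ab True corner_pos by simp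
    then show False using ab by (metis h_pv_vertex less_irrefl)
  next
    case False
    have "h a (u b) > 0" using ab False h_pos by simp
    then show False using ab by (metis h_vertex(1) less_irrefl)
  qed
qed

text \<open>A point of two closed cones sees both apexes as tangency points, so the two apexes are
  aligned with it; convexity leaves only neighbouring apexes.\<close>

lemma closed_cone_inter:
  assumes "a < d" "b < d" "a \<noteq> b" "y \<in> CC a" "y \<in> CC b"
  shows "b = nx a \<or> a = nx b"
proof (rule ccontr)
  assume *: "\<not> (b = nx a \<or> a = nx b)"
  have "cross (u a - y) (u b - u a) \<ge> 0" "cross (u b - y) (u a - u b) \<ge> 0"
    using closed_cone_tangent assms by auto
  then have 0: "cross (u a - y) (u b - u a) = 0"
    by (simp add: cross_simps algebra_simps)
  have "b \<noteq> pv a" "a \<noteq> pv b" using * assms by auto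
  \<comment> \<open>For a non-neighbour \<open>b\<close> both edge functions at \<open>u a\<close>
    are positive at \<open>u b\<close>. The two nonnegative terms of \<open>pluecker\<close> sum to
    0, so both edge functions vanish at \<open>z\<close>, which leaves only the apex.\<close>
  have key: "z = u a" if "cross (u a - z) (u b - u a) = 0" "z \<in> CC a" "a < d" "b < d" "a \<noteq> b"
    "b \<noteq> nx a" "b \<noteq> pv a" for a b z
  proof -
    have p: "h a (u b) > 0" "h (pv a) (u b) > 0"
      using that by (auto intro!: h_pos)
    have "h a z * h (pv a) (u b) - h (pv a) z * h a (u b) = 0"
      using pluecker[OF \<open>a < d\<close>, of z "u b"] that by simp
    moreover have "h a z * h (pv a) (u b) \<ge> 0" "- h (pv a) z * h a (u b) \<ge> 0"
      using that p by (auto simp: closed_cone_def mult_nonpos_nonneg)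
    ultimately have "h a z * h (pv a) (u b) = 0" "h (pv a) z * h a (u b) = 0" by auto
    then show ?thesis using p that by (intro both_zero_imp_vertex) auto
  qed
  have "y = u a" using key[of a y b] 0 assms * \<open>b \<noteq> pv a\<close> by auto
  moreover have "cross (u b - y) (u a - u b) = 0"
    using 0 by (simp add: cross_simps algebra_simps)
  then have "y = u b" using key[of b y a] assms * \<open>a \<noteq> pv b\<close> by auto
  ultimately show False using vertex_inj assms by metis
qed

text \<open>A step about \<open>u k\<close> reverses the sign of \<open>h k\<close>, so it leaves
  the open cone of \<open>k\<close> and the next letter differs.\<close>

lemma open_itinerary_imp_closed_itinerary:
  assumes "0 < l" "set w \<subseteq> {..<d}" "open_itinerary d u l w z"
  shows "closed_itinerary d u l w z"
  using assms(2,3)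
proof (induction w arbitrary: z)
  case (Cons k w)
  have "h k (step l (u k) z) < 0"
    using Cons.prems \<open>0 < l\<close> by (simp add: side_step open_cone_def)
  then have "w \<noteq> [] \<longrightarrow> hd w \<noteq> k"
    using Cons.prems by (cases w) (auto simp: open_cone_def)
  with Cons show ?case by (auto simp: open_cone_def closed_cone_def)
qed simp

text \<open>For \<open>a < d\<close> the two cones force \<open>h a\<close> to be 0: this is the
  singular half-line that prolongs edge \<open>a\<close> backwards beyond \<open>u a\<close>. On it
  the next letter is ambiguous between \<open>a\<close> and \<open>nx a\<close>.\<close>

abbreviation "ray a \<equiv> CC a \<inter> CC (nx a)"

text \<open>
  For other \<open>l\<close>, an orbit returns to the line of the edge \<open>a\<close> only along words in \<open>a\<close> and \<open>nx a\<close>.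
\<close>

definition exceptional :: "real set" where
  "exceptional = {l. \<exists>a<d. \<exists>w. set w \<subseteq> {..<d} \<and> \<not> set w \<subseteq> {a, nx a} \<and> word_sum d u a w l = 0}"

text \<open>A return makes \<open>word_sum\<close> vanish, so the word uses only \<open>a\<close>
  and \<open>nx a\<close>. But the step about \<open>u (nx a)\<close> carries the ray to where
  \<open>h (pv a)\<close> is positive, outside the closed cone of \<open>a\<close>; neither ending
  there nor continuing with \<open>a\<close> is possible, and \<open>nx a\<close> may not be
  repeated.\<close>

lemma no_return_nx:
  assumes a: "a < d" and l: "0 < l" "l \<notin> exceptional"
    and w: "set w \<subseteq> {..<d}" "w = nx a # w'" "closed_itinerary d u l w y"
    and y: "y \<in> ray a" "walk u l w y \<in> ray a"
  shows False
proof -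
  have h0: "h a z = 0" if "z \<in> ray a" for z
    using that a by (auto simp: closed_cone_def)
  have "word_sum d u a w l = 0"
    using side_walk[of d u a l w y] h0[OF y(1)] h0[OF y(2)] l by simp
  then have sub: "set w \<subseteq> {a, nx a}"
    using l(2) a w(1) unfolding exceptional_def by blast
  have "h (pv a) y \<le> 0" using y by (auto simp: closed_cone_def)
  moreover have "h (pv a) (step l (u (nx a)) y) = - l * h (pv a) y + (1 + l) * h (pv a) (u (nx a))"
    by (rule side_step)
  ultimately have "h (pv a) (step l (u (nx a)) y) > 0"
    using l corner_pos[OF a] by (smt (verit) mult_nonneg_nonneg mult_pos_pos mult_minus_left mult_nonneg_nonpos)
  then have nin: "step l (u (nx a)) y \<notin> CC a" by (auto simp: closed_cone_def)
  show False
  proof (cases w')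
    case Nil
    then show False using y w nin by simp
  next
    case (Cons b w'')
    then have "b = a" using w sub by auto
    then show False using Cons w nin by simp
  qed
qed

text \<open>Again the word uses only \<open>a\<close> and \<open>nx a\<close>, so it begins with
  \<open>a, nx a\<close>. All points stay on the line of edge \<open>a\<close>, and after these two
  letters the point is on or beyond the end \<open>u (nx a)\<close>, whereas the cone of
  \<open>a\<close> meets this line only behind \<open>u a\<close>.\<close>

lemma no_return_self:
  assumes a: "a < d" and l: "0 < l" "l \<notin> exceptional"
    and w: "set w \<subseteq> {..<d}" "w = a # w'" "closed_itinerary d u l (w @ [a]) y"
    and y: "y \<in> ray a" "walk u l w y \<in> ray a"
  shows False
proof -
  let ?b = "nx a"
  have h0: "h a z = 0" if "z \<in> ray a" for z
    using that a by (auto simp: closed_cone_def)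
  have "word_sum d u a w l = 0"
    using side_walk[of d u a l w y] h0[OF y(1)] h0[OF y(2)] l by simp
  then have sub: "set w \<subseteq> {a, ?b}"
    using l(2) a w(1) unfolding exceptional_def by blast
  \<comment> \<open>Here the letter \<open>a\<close> appended to \<open>w\<close> matters:
    \<open>w = [a]\<close> would give the repetition \<open>[a, a]\<close>.\<close>
  have "w' \<noteq> []" using w by auto
  then obtain b w2 where w': "w' = b # w2" by (cases w') auto
  then have b: "b = ?b" using w sub by auto
  define y1 where "y1 = step l (u a) y"
  define y2 where "y2 = step l (u ?b) y1"
  have cp: "y1 \<in> CC ?b" "closed_itinerary d u l (w2 @ [a]) y2"
    using w w' b by (auto simp: y1_def y2_def)
  have y2h: "h a y2 = 0"
    using h0[OF y(1)] by (simp add: y2_def y1_def side_step)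
  have "h ?b y1 \<ge> 0" using cp by (simp add: closed_cone_def)
  then have y2n: "h ?b y2 \<le> 0" using l by (simp add: y2_def side_step)
  have nin: "y2 \<notin> CC a"
  proof
    assume y2C: "y2 \<in> CC a"
    have "h (pv a) y2 \<le> 0" using y2C by (simp add: closed_cone_def)
    have "cross (u ?b - u a) (y2 - u a) = 0" using y2h by (simp add: side_def)
    then obtain s where "y2 - u a = of_real s * (u ?b - u a)"
      using cross_collinear vertex_inj[of ?b a] a by (metis nx_lt nx_neq(1) right_minus_eq)
    then have s: "y2 = u a + of_real s * (u ?b - u a)" by (simp add: algebra_simps)
    have "h (pv a) y2 = s * h (pv a) (u ?b)"
      using a by (simp add: s side_def cross_simps algebra_simps)
    then have "s \<le> 0" using \<open>h (pv a) y2 \<le> 0\<close> corner_pos[OF a] by (simp add: mult_le_0_iff)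
    have "h ?b y2 = (1 - s) * h ?b (u a)"
      by (simp add: s side_def cross_simps algebra_simps)
    moreover have "h ?b (u a) > 0" using a by (intro h_pos) auto
    ultimately show False using y2n \<open>s \<le> 0\<close> by (simp add: mult_le_0_iff)
  qed
  show False
  proof (cases w2)
    case Nil
    then show False using y w w' b nin by (simp add: y1_def y2_def)
  next
    case (Cons c w3)
    then have "c = a" using w w' b sub by auto
    then show False using Cons cp nin by simp
  qed
qed

text \<open>Two itineraries of one point can part only on a ray, where one takes \<open>a\<close>
  and the other \<open>nx a\<close>. Since no ray is met twice, the set of rays at which the letter
  \<open>a\<close> was taken determines the word, and there are \<open>2 ^ d\<close> such
  sets.\<close>

lemma card_closed_itineraries:
  fixes z :: complex and m :: nat
  assumes l: "0 < l" "l \<notin> exceptional"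
  defines "W \<equiv> {w. length w = m \<and> set w \<subseteq> {..<d} \<and> closed_itinerary d u l w z}"
  shows "card W \<le> 2 ^ d"
proof -
  define D where "D w = {a. a < d \<and> (\<exists>p s. w = p @ a # s \<and> walk u l p z \<in> ray a)}" for w
  have key: False if ww: "w \<in> W" "w' \<in> W" "D w = D w'" and w: "w = p @ a # s"
    and w': "w' = p @ nx a # s'" for w w' p a s s'
  proof -
    define y where "y = walk u l p z"
    have a: "a < d" using ww w by (auto simp: W_def)
    have "closed_itinerary d u l (a # s) y" "closed_itinerary d u l (nx a # s') y"
      using ww w w' closed_itinerary_appendD(2) unfolding W_def y_def by blast+
    then have "y \<in> CC a" "y \<in> CC (nx a)" by auto
    then have y: "y \<in> ray a" by simp
    then have "a \<in> D w" using a w by (auto simp: D_def y_def)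
    then have "a \<in> D w'" using ww by simp
    then obtain p' t where t: "w' = p' @ a # t" "walk u l p' z \<in> ray a"
      by (auto simp: D_def)
    from t w' have "p @ nx a # s' = p' @ a # t" by simp
    then consider q where "p' = p @ q" "nx a # s' = q @ a # t"
      | q where "p = p' @ q" "q @ nx a # s' = a # t"
      by (auto simp: append_eq_append_conv2)
    then show False
    proof cases
      case 1
      then obtain q' where q: "q = nx a # q'" using a by (cases q) auto
      have "closed_itinerary d u l (p @ (q @ (a # t))) z" "set q \<subseteq> {..<d}"
        using ww 1 w' t by (auto simp: W_def)
      then have "closed_itinerary d u l q y" 
        unfolding y_def using closed_itinerary_appendD by blast
      then show False
        using no_return_nx[OF a l \<open>set q \<subseteq> {..<d}\<close> q _ y] t 1 by (simp add: walk_append y_def)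
    next
      case 2
      then obtain q' where q: "q = a # q'" using a by (cases q) auto
      \<comment> \<open>The prefix \<open>p = p' @ q\<close> is common to both words, and it is
        \<open>w\<close> that continues with \<open>a\<close> at the second visit; this supplies the
        extra letter in \<open>no_return_self\<close>.\<close>
      have "closed_itinerary d u l (p' @ ((q @ [a]) @ s)) z" "set q \<subseteq> {..<d}"
        using ww 2 w by (auto simp: W_def)
      then have "closed_itinerary d u l (q @ [a]) (walk u l p' z)"
        using closed_itinerary_appendD by blast
      then show False
        using no_return_self[OF a l \<open>set q \<subseteq> {..<d}\<close> q _ t(2)] y 2 by (simp add: walk_append y_def)
    qed
  qed
  have "inj_on D W"
  proof (rule inj_onI, rule ccontr)
    fix w w' assume ww: "w \<in> W" "w' \<in> W" "D w = D w'" "w \<noteq> w'"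
    then have "length w = length w'" by (simp add: W_def)
    then obtain p a s b s' where *: "a \<noteq> b" "w = p @ [a] @ s" "w' = p @ [b] @ s'"
      using same_length_different[of w w'] ww(4) by blast
    have "closed_itinerary d u l (a # s) (walk u l p z)"
      "closed_itinerary d u l (b # s') (walk u l p z)" "a < d" "b < d"
      using ww * closed_itinerary_appendD(2)[of d u l p _ z] by (auto simp: W_def simp del: closed_itinerary.simps)
    then have "walk u l p z \<in> CC a" "walk u l p z \<in> CC b" "a < d" "b < d" by auto
    then consider "b = nx a" | "a = nx b" using closed_cone_inter * by blast
    then show False
      using key[of w w' p a s s'] key[of w' w p b s' s] ww * by cases auto
  qed
  moreover have "D ` W \<subseteq> Pow {..<d}" by (auto simp: D_def)
  ultimately have "card W \<le> card (Pow {..<d})"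
    by (metis card_inj_on_le finite_Pow_iff finite_lessThan)
  then show ?thesis by (simp add: card_Pow)
qed

text \<open>The run has to alternate. Let \<open>D\<close> be the value of \<open>h (pv a)\<close>
  at \<open>u (nx a)\<close>: every two letters multiply \<open>D - h (pv a)\<close> by at most
  \<open>l\<^sup>2\<close>, yet at the last point, in the cone of \<open>a\<close>, it is at least
  \<open>D > 0\<close>. So a long run must start far away.\<close>

lemma short_runs:
  assumes "0 < l" "a < d" "set q \<subseteq> {a, nx a}" "length q = 2 * j + 1" "hd q = a" "closed_itinerary d u l q y"
  shows "h (pv a) (u (nx a)) \<le> l ^ (2 * j) * (h (pv a) (u (nx a)) - h (pv a) y)"
  using assms(3-)
proof (induction j arbitrary: q y)
  case 0
  then have "y \<in> CC a" by (cases q) auto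
  then show ?case by (simp add: closed_cone_def)
next
  case (Suc j)
  let ?D = "h (pv a) (u (nx a))"
  obtain b c q' where q: "q = a # b # c # q'"
    using Suc.prems by (cases q; cases "tl q"; cases "tl (tl q)") auto
  then have bc: "b = nx a" "c = a" using Suc.prems by auto
  define y2 where "y2 = step l (u (nx a)) (step l (u a) y)"
  have "?D \<le> l ^ (2 * j) * (?D - h (pv a) y2)"
    using Suc.prems q bc by (intro Suc.IH[of "c # q'"]) (auto simp: y2_def)
  also have "h (pv a) y2 = l\<^sup>2 * h (pv a) y + (1 + l) * ?D"
    using \<open>a < d\<close> by (simp add: y2_def side_step power2_eq_square)
  also have "l ^ (2 * j) * (?D - (l\<^sup>2 * h (pv a) y + (1 + l) * ?D)) \<le> l ^ (2 * j) * (l\<^sup>2 * (?D - h (pv a) y))"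
  proof (intro mult_left_mono)
    have "l * ?D > 0" "l\<^sup>2 * ?D > 0" using corner_pos[OF \<open>a < d\<close>] \<open>0 < l\<close> by auto
    then show "?D - (l\<^sup>2 * h (pv a) y + (1 + l) * ?D) \<le> l\<^sup>2 * (?D - h (pv a) y)"
      by (simp add: algebra_simps)
  qed (use \<open>0 < l\<close> in auto)
  finally show ?case by (simp add: power2_eq_square mult_ac)
qed

end

section \<open>Sublevel sets of power series\<close>

text \<open>Here \<open>g i\<close> is the \<open>i\<close>-th derivative of \<open>g 0\<close>.
  Induction on the order splits the interval according to whether the highest derivative below the
  bounded one is small, large positive or large negative. The first part lies in a single ball and
  each of the others is an interval for the induction hypothesis, so \<open>1 + 2 * 3 ^ r\<close>
  balls suffice.\<close>

lemma sublevel_cover: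
  fixes g :: "nat \<Rightarrow> real \<Rightarrow> real"
  assumes "convex S"
    and "\<And>i x. \<lbrakk>i < r; x \<in> S\<rbrakk> \<Longrightarrow> (g i has_real_derivative g (Suc i) x) (at x)"
    and "\<And>x. x \<in> S \<Longrightarrow> \<bar>g r x\<bar> \<ge> c" and "0 < c" "0 < \<rho>" "\<eta> < c * \<rho> ^ r"
  shows "\<exists>N. finite N \<and> card N \<le> 3 ^ r \<and> {x \<in> S. \<bar>g 0 x\<bar> \<le> \<eta>} \<subseteq> (\<Union>t\<in>N. cball t (2 * \<rho>))"
  using assms
proof (induction r arbitrary: S c)
  case 0
  then have "{x \<in> S. \<bar>g 0 x\<bar> \<le> \<eta>} = {}" by force
  then show ?case by (intro exI[of _ "{}"]) auto
next
  case (Suc r)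
  let ?E = "\<lambda>A. {x \<in> A. \<bar>g 0 x\<bar> \<le> \<eta>}"
  have mvt: "\<exists>z\<in>S. x < z \<and> z < y \<and> g r y - g r x = (y - x) * g (Suc r) z"
    if "x \<in> S" "y \<in> S" "x < y" for x y
  proof -
    have "{x..y} \<subseteq> S" using that \<open>convex S\<close>
      by (metis convex_contains_segment closed_segment_eq_real_ivl less_imp_le)
    then have "\<exists>z>x. z < y \<and> g r y - g r x = (y - x) * g (Suc r) z"
      using Suc.prems(2) that by (intro MVT2) auto
    then show ?thesis using \<open>{x..y} \<subseteq> S\<close> by (metis atLeastAtMost_iff less_imp_le subsetD)
  qed
  have far: "c * \<bar>y - x\<bar> \<le> \<bar>g r y - g r x\<bar>" if "x \<in> S" "y \<in> S" for x y
  proof -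
    have *: "c * \<bar>y - x\<bar> \<le> \<bar>g r y - g r x\<bar>" if xy: "x \<in> S" "y \<in> S" "x < y" for x y
    proof -
      obtain z where "z \<in> S" "g r y - g r x = (y - x) * g (Suc r) z" using mvt[of x y] xy by blast
      then show ?thesis using Suc.prems(3)[of z] xy
        by (simp add: abs_mult mult.commute mult_left_mono)
    qed
    show ?thesis using *[OF that] *[OF that(2,1)] by (cases x y rule: linorder_cases) auto
  qed
  have cont: "continuous_on S (g r)"
    using Suc.prems(2)[of r] by (intro continuous_at_imp_continuous_on) (auto intro: DERIV_isCont)
  \<comment> \<open>As \<open>g r\<close> separates points at rate at least \<open>c\<close>, it is
    at most \<open>\<tau>\<close> in modulus only on a set of diameter at most
    \<open>2 * \<rho>\<close>. Elsewhere \<open>\<tau>\<close> replaces \<open>c\<close> in the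
    induction hypothesis, because \<open>c * \<rho> ^ Suc r = \<tau> * \<rho> ^ r\<close>.\<close>
  define \<tau> where "\<tau> = c * \<rho>"
  have "0 < \<tau>" using Suc.prems by (simp add: \<tau>_def)
  have inj: "inj_on (g r) S"
  proof (rule inj_onI)
    fix x y assume "x \<in> S" "y \<in> S" "g r x = g r y"
    then show "x = y" using far[of x y] \<open>0 < c\<close> by (simp add: mult_le_0_iff)
  qed
  have mono: "strict_mono_on S (g r) \<or> strict_antimono_on S (g r)"
    using injective_eq_monotone_map[OF is_interval_convex_1[THEN iffD2, OF \<open>convex S\<close>] cont] inj
    by blast
  have conv: "convex {x \<in> S. \<tau> < s * g r x}" if "s = 1 \<or> s = -1" for s :: real
    unfolding is_interval_convex_1[of "{x \<in> S. \<tau> < s * g r x}", symmetric] is_interval_1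
  proof safe
    fix a b x assume x: "a \<in> S" "b \<in> S" "\<tau> < s * g r a" "\<tau> < s * g r b" "a \<le> x" "x \<le> b"
    show "x \<in> S" using x is_interval_convex_1[THEN iffD2, OF \<open>convex S\<close>] unfolding is_interval_1 by blast
    have "(g r a \<le> g r x \<and> g r x \<le> g r b) \<or> (g r a \<ge> g r x \<and> g r x \<ge> g r b)"
      using mono
    proof
      assume "strict_mono_on S (g r)"
      then have "mono_on S (g r)" by (rule strict_mono_on_imp_mono_on)
      then show ?thesis using x \<open>x \<in> S\<close> by (auto simp: monotone_on_def)
    next
      assume "strict_antimono_on S (g r)"
      then have "antimono_on S (g r)" unfolding monotone_on_def by (metis order_le_less)
      then show ?thesis using x \<open>x \<in> S\<close> by (auto simp: monotone_on_def)
    qed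
    then show "\<tau> < s * g r x" using x that by auto
  qed
  have IH: "\<exists>N. finite N \<and> card N \<le> 3 ^ r \<and> ?E {x \<in> S. \<tau> < s * g r x} \<subseteq> (\<Union>t\<in>N. cball t (2 * \<rho>))"
    if "s = 1 \<or> s = -1" for s :: real
  proof (rule Suc.IH[OF conv[OF that], of \<tau>])
    show "\<eta> < \<tau> * \<rho> ^ r" using Suc.prems by (simp add: \<tau>_def mult.assoc)
  qed (use Suc.prems that \<open>0 < \<tau>\<close> in auto)
  obtain N1 where N1: "finite N1" "card N1 \<le> 3 ^ r" "?E {x \<in> S. \<tau> < 1 * g r x} \<subseteq> (\<Union>t\<in>N1. cball t (2 * \<rho>))"
    using IH[of 1] by auto
  obtain N2 where N2: "finite N2" "card N2 \<le> 3 ^ r" "?E {x \<in> S. \<tau> < -1 * g r x} \<subseteq> (\<Union>t\<in>N2. cball t (2 * \<rho>))"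
    using IH[of "-1"] by auto
  have "\<exists>t. {x \<in> S. \<bar>g r x\<bar> \<le> \<tau>} \<subseteq> cball t (2 * \<rho>)"
  proof (cases "{x \<in> S. \<bar>g r x\<bar> \<le> \<tau>} = {}")
    case False
    then obtain t where t: "t \<in> S" "\<bar>g r t\<bar> \<le> \<tau>" by auto
    have "\<bar>t - x\<bar> \<le> 2 * \<rho>" if "x \<in> S" "\<bar>g r x\<bar> \<le> \<tau>" for x
    proof -
      have "c * \<bar>t - x\<bar> \<le> 2 * \<tau>" using far[of x t] t that by linarith
      then show ?thesis using \<open>0 < c\<close> by (simp add: \<tau>_def)
    qed
    then show ?thesis by (intro exI[of _ t]) (auto simp: dist_real_def)
  qed auto
  then obtain t where t: "{x \<in> S. \<bar>g r x\<bar> \<le> \<tau>} \<subseteq> cball t (2 * \<rho>)" by blast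
  show ?case
  proof (intro exI[of _ "insert t (N1 \<union> N2)"] conjI)
    have "card (insert t (N1 \<union> N2)) \<le> Suc (card (N1 \<union> N2))"
      using N1(1) N2(1) by (simp add: card_insert_if)
    also have "\<dots> \<le> Suc (card N1 + card N2)" using card_Un_le by simp
    also have "\<dots> \<le> 3 ^ Suc r"
    proof -
      have "1 \<le> (3::nat) ^ r" by simp
      then show ?thesis using N1(2) N2(2) unfolding power_Suc by linarith
    qed
    finally show "card (insert t (N1 \<union> N2)) \<le> 3 ^ Suc r" .
    show "?E S \<subseteq> (\<Union>t\<in>insert t (N1 \<union> N2). cball t (2 * \<rho>))"
    proof
      fix x assume x: "x \<in> ?E S"
      consider "\<bar>g r x\<bar> \<le> \<tau>" | "\<tau> < g r x" | "\<tau> < - g r x" by linarith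
      then show "x \<in> (\<Union>t\<in>insert t (N1 \<union> N2). cball t (2 * \<rho>))"
      proof cases
        case 1
        then show ?thesis using x t by auto
      next
        case 2
        then have "x \<in> ?E {x \<in> S. \<tau> < 1 * g r x}" using x by simp
        then show ?thesis using N1(3) by blast
      next
        case 3
        then have "x \<in> ?E {x \<in> S. \<tau> < -1 * g r x}" using x by simp
        then show ?thesis using N2(3) by blast
      qed
    qed
  qed (use N1 N2 in auto)
qed

section \<open>Uniform order of vanishing of bounded power series\<close>

lemma funpow_diffs:
  fixes c :: "nat \<Rightarrow> 'a::comm_ring_1"
  shows "(diffs ^^ r) c n = (diffs ^^ r) (\<lambda>_. 1) n * c (n + r)"
  by (induction r arbitrary: n) (auto simp: diffs_def algebra_simps)

lemma funpow_diffs_one_pos: "(diffs ^^ r) (\<lambda>_. 1 :: real) n > 0"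
  by (induction r arbitrary: n) (auto simp: diffs_def)

text \<open>On the open unit disc and for bounded \<open>c\<close> this is the \<open>r\<close>-th
  derivative of the power series. The formal definition serves real and complex arguments
  alike.\<close>

definition der_series :: "nat \<Rightarrow> (nat \<Rightarrow> 'a::{real_normed_field,banach}) \<Rightarrow> 'a \<Rightarrow> 'a" where
  "der_series r c x = (\<Sum>n. (diffs ^^ r) c n * x ^ n)"

lemma summable_der_series:
  fixes c :: "nat \<Rightarrow> 'a::{real_normed_field,banach}"
  assumes "\<And>j. norm (c j) \<le> M" "norm x < 1"
  shows "summable (\<lambda>n. (diffs ^^ r) c n * x ^ n)"
  using assms(2)
proof (induction r arbitrary: x)
  case 0
  have "summable (\<lambda>n. M * norm x ^ n)" using 0 by (intro summable_mult summable_geometric) auto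
  then show ?case
    by (rule summable_comparison_test') (auto simp: norm_mult norm_power intro!: mult_right_mono assms)
next
  case (Suc r)
  then show ?case using termdiff_converges[of x 1 "(diffs ^^ r) c"] by simp
qed

lemma der_series_deriv:
  fixes c :: "nat \<Rightarrow> 'a::{real_normed_field,banach}"
  assumes "\<And>j. norm (c j) \<le> M" "norm x < 1"
  shows "(der_series r c has_field_derivative der_series (Suc r) c x) (at x)"
proof -
  obtain K where K: "norm x < K" "K < 1" using assms dense by blast
  then have "norm (of_real K :: 'a) < 1" using norm_ge_zero[of x] by (simp del: norm_ge_zero)
  then have "summable (\<lambda>n. (diffs ^^ r) c n * of_real K ^ n)"
    using summable_der_series[of c M] assms by blast
  moreover have "norm x < norm (of_real K :: 'a)" using K norm_ge_zero[of x] by (simp del: norm_ge_zero)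
  ultimately show ?thesis
    unfolding der_series_def using termdiffs_strong by fastforce
qed

text \<open>The expansion point is \<open>x\<close>, not 0, so the coefficients are reached through
  the identity theorem for the holomorphic extension to the unit disc.\<close>

lemma der_series_eq_0D:
  fixes c :: "nat \<Rightarrow> real"
  assumes M: "\<And>j. \<bar>c j\<bar> \<le> M" and x: "\<bar>x\<bar> < 1" and 0: "\<And>r. der_series r c x = 0"
  shows "c j = 0"
proof -
  define C where "C n = complex_of_real (c n)" for n
  define F where "F = der_series 0 C"
  have CM: "norm (C j) \<le> M" for j using M by (simp add: C_def)
  have D: "(deriv ^^ r) F z = der_series r C z" if "z \<in> ball 0 1" for r z
    using that
  proof (induction r arbitrary: z)
    case (Suc r)
    have "(der_series r C has_field_derivative der_series (Suc r) C z) (at z)"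
      using Suc.prems CM by (intro der_series_deriv) auto
    then have "((deriv ^^ r) F has_field_derivative der_series (Suc r) C z) (at z)"
      by (rule has_field_derivative_transform_within_open[where S = "ball 0 1"])
        (use Suc in auto)
    then show ?case by (simp add: DERIV_imp_deriv)
  qed (simp add: F_def)
  have hol: "(deriv ^^ r) F holomorphic_on ball 0 1" for r
  proof -
    have "F holomorphic_on ball 0 1"
      unfolding F_def holomorphic_on_open[OF open_ball] using der_series_deriv[of C, OF CM] by fastforce
    then show ?thesis by (intro holomorphic_higher_deriv) auto
  qed
  have dC: "(diffs ^^ r) C n = of_real ((diffs ^^ r) c n)" for r n
    by (induction r arbitrary: n) (auto simp: C_def diffs_def)
  have z0: "(deriv ^^ r) F (of_real x) = 0" for r
  proof -
    have "(deriv ^^ r) F (of_real x) = der_series r C (of_real x)" using x by (intro D) auto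
    also have "\<dots> = (\<Sum>n. of_real ((diffs ^^ r) c n * x ^ n))"
      by (simp add: der_series_def dC)
    also have "\<dots> = of_real (der_series r c x)"
      unfolding der_series_def
      by (rule suminf_of_real[symmetric]) (use summable_der_series[of c M x] M x in auto)
    finally show ?thesis using 0 by simp
  qed
  \<comment> \<open>The identity theorem is applied to the \<open>j\<close>-th derivative, whose
    value at 0 is a positive multiple of \<open>c j\<close>.\<close>
  have "(deriv ^^ j) F 0 = 0"
  proof (rule holomorphic_fun_eq_0_on_connected[where f = "(deriv ^^ j) F" and S = "ball 0 1" and z = "of_real x" and w = 0])
    show "(deriv ^^ n) ((deriv ^^ j) F) (of_real x) = 0" for n
      using z0[of "n + j"] by (simp add: funpow_add)
  qed (use hol x in auto)
  then have "(diffs ^^ j) C 0 = 0" by (simp add: D der_series_def)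
  then have "(diffs ^^ j) c 0 = 0" by (simp add: dC)
  then show ?thesis using funpow_diffs[of j c 0] funpow_diffs_one_pos[of j 0] by simp
qed

text \<open>Tychonoff: the cube of sequences with values in \<open>{-M..M}\<close> is compact, and
  convergence in the product topology is coordinatewise.\<close>

lemma bounded_sequences_subseq:
  fixes f :: "nat \<Rightarrow> nat \<Rightarrow> real"
  assumes "\<And>k j. \<bar>f k j\<bar> \<le> M"
  shows "\<exists>s g. strict_mono s \<and> (\<forall>j. (\<lambda>k. f (s k) j) \<longlonglongrightarrow> g j)"
proof -
  have "compactin (product_topology (\<lambda>_. euclidean) UNIV) (PiE UNIV (\<lambda>_::nat. {-M..M::real}))"
    by (simp add: compactin_PiE)
  then have "compact (PiE UNIV (\<lambda>_::nat. {-M..M::real}))"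
    by (simp add: euclidean_product_topology)
  then have "seq_compact (PiE UNIV (\<lambda>_::nat. {-M..M::real}))"
    by (rule compact_imp_seq_compact)
  moreover have "\<forall>k. f k \<in> PiE UNIV (\<lambda>_::nat. {-M..M})"
    using assms by (auto simp: PiE_UNIV_domain abs_le_iff minus_le_iff)
  ultimately obtain g s where s: "strict_mono s" "(f \<circ> s) \<longlonglongrightarrow> g"
    unfolding seq_compact_def by metis
  have "(\<lambda>k. f (s k) j) \<longlonglongrightarrow> g j" for j
  proof -
    have "isCont (\<lambda>x. x j) g"
      using continuous_on_product_coordinates[of j] continuous_on_eq_continuous_at[OF open_UNIV] by blast
    from isCont_tendsto_compose[OF this s(2)] show ?thesis by (simp add: o_def)
  qed
  then show ?thesis using s by blast
qed

text \<open>Otherwise there are series whose derivatives up to order \<open>k\<close> all come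
  within \<open>1 / (k + 1)\<close> of 0 near \<open>x0\<close>. A limit of their coefficients has
  all derivatives 0 at \<open>x0\<close>, hence is the zero sequence. The fixed bound
  \<open>J\<close> on the index of the large coefficient prevents that coefficient from escaping to
  infinity in the limit.\<close>

lemma der_series_lower_bound:
  fixes x0 c M :: real
  assumes x0: "0 < x0" "x0 < 1" and c: "0 < c"
  obtains \<epsilon> K where "0 < \<epsilon>"
    "\<And>f. \<lbrakk>\<And>j. \<bar>f j\<bar> \<le> M; \<exists>j<J. c \<le> \<bar>f j\<bar>\<rbrakk> \<Longrightarrow> \<exists>r\<le>K. \<forall>x. \<bar>x - x0\<bar> < \<epsilon> \<longrightarrow> \<epsilon> \<le> \<bar>der_series r f x\<bar>"
proof (rule ccontr)
  assume "\<not> thesis"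
  then have neg: "\<And>\<epsilon> K. 0 < \<epsilon> \<Longrightarrow> \<exists>f. (\<forall>j. \<bar>f j\<bar> \<le> M) \<and> (\<exists>j<J. c \<le> \<bar>f j\<bar>) \<and>
       (\<forall>r\<le>K. \<exists>x. \<bar>x - x0\<bar> < \<epsilon> \<and> \<bar>der_series r f x\<bar> < \<epsilon>)"
    using that by (metis not_le)
  have "\<forall>k. \<exists>f. (\<forall>j. \<bar>f j\<bar> \<le> M) \<and> (\<exists>j<J. c \<le> \<bar>f j\<bar>) \<and>
       (\<forall>r\<le>k. \<exists>x. \<bar>x - x0\<bar> < inverse (Suc k) \<and> \<bar>der_series r f x\<bar> < inverse (Suc k))"
    by (intro allI neg) simp
  from choice[OF this] obtain f where f: "\<And>k j. \<bar>f k j\<bar> \<le> M" "\<And>k. \<exists>j<J. c \<le> \<bar>f k j\<bar>"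
    "\<And>k r. r \<le> k \<Longrightarrow> \<exists>x. \<bar>x - x0\<bar> < inverse (Suc k) \<and> \<bar>der_series r (f k) x\<bar> < inverse (Suc k)"
    by blast
  obtain s g where s: "strict_mono s" "\<And>j. (\<lambda>k. f (s k) j) \<longlonglongrightarrow> g j"
    using bounded_sequences_subseq[of f M] f(1) by blast
  have gM: "\<bar>g j\<bar> \<le> M" for j
    using tendsto_rabs[OF s(2)[of j]] f(1) by (intro LIMSEQ_le_const2) auto
  have inv0: "(\<lambda>k. inverse (real (Suc (s k)))) \<longlonglongrightarrow> 0"
    using LIMSEQ_subseq_LIMSEQ[OF LIMSEQ_inverse_real_of_nat s(1)] by (simp add: o_def)
  have "der_series r g x0 = 0" for r
  proof -
    obtain X where X: "\<And>k. r \<le> k \<Longrightarrow> \<bar>X k - x0\<bar> < inverse (Suc k) \<and> \<bar>der_series r (f k) (X k)\<bar> < inverse (Suc k)"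
      using f(3)[of r] by metis
    have ev: "\<forall>\<^sub>F k in sequentially. r \<le> s k"
      using eventually_ge_at_top[of r] by eventually_elim (meson le_trans seq_suble s(1))
    have lim0: "(\<lambda>k. der_series r (f (s k)) (X (s k))) \<longlonglongrightarrow> 0"
      by (rule Lim_null_comparison[OF _ inv0], rule eventually_mono[OF ev]) (metis X less_imp_le real_norm_def)
    have "(\<lambda>k. X (s k) - x0) \<longlonglongrightarrow> 0"
      by (rule Lim_null_comparison[OF _ inv0], rule eventually_mono[OF ev]) (metis X less_imp_le real_norm_def)
    then have Xlim: "(\<lambda>k. X (s k)) \<longlonglongrightarrow> x0" by (simp add: LIM_zero_iff)
    obtain b where b: "x0 < b" "b < 1" using x0 dense by blast
    have evb: "\<forall>\<^sub>F k in sequentially. \<bar>X (s k)\<bar> \<le> b"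
      using order_tendstoD(2)[OF tendsto_rabs[OF Xlim], of b] b x0 by (auto elim: eventually_mono)
    \<comment> \<open>Tannery's theorem interchanges limit and sum. The majorant belongs to the
      constant sequence \<open>M\<close> at \<open>b\<close>, a point between \<open>x0\<close> and
      1 that eventually bounds the arguments.\<close>
    have "(\<lambda>k. \<Sum>n. (diffs ^^ r) (f (s k)) n * X (s k) ^ n) \<longlonglongrightarrow> (\<Sum>n. (diffs ^^ r) g n * x0 ^ n)"
    proof (rule tannerys_theorem[THEN conjunct2, THEN conjunct2])
      show "(\<lambda>k. (diffs ^^ r) (f (s k)) n * X (s k) ^ n) \<longlonglongrightarrow> (diffs ^^ r) g n * x0 ^ n" for n
        unfolding funpow_diffs[of r "f _"] funpow_diffs[of r g]
        by (intro tendsto_intros s Xlim)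
      let ?B = "\<lambda>n. (diffs ^^ r) (\<lambda>_. M) n * b ^ n"
      show "summable ?B"
        using b x0 f(1)[of 0 0] by (intro summable_der_series[of _ "\<bar>M\<bar>"]) auto
      have "\<forall>\<^sub>F k in sequentially. \<forall>n. norm ((diffs ^^ r) (f (s k)) n * X (s k) ^ n) \<le> ?B n"
        using evb
      proof eventually_elim
        case (elim k)
        show ?case
        proof
          fix n
          have "\<bar>(diffs ^^ r) (f (s k)) n\<bar> \<le> (diffs ^^ r) (\<lambda>_. M) n"
            unfolding funpow_diffs[of r "f _"] funpow_diffs[of r "\<lambda>_. M"]
            using f(1) funpow_diffs_one_pos[of r n] by (simp add: abs_mult mult_left_mono)
          moreover have "\<bar>X (s k)\<bar> ^ n \<le> b ^ n" using elim by (intro power_mono) auto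
          ultimately show "norm ((diffs ^^ r) (f (s k)) n * X (s k) ^ n) \<le> ?B n"
            by (simp add: abs_mult power_abs mult_mono')
        qed
      qed
      then show "\<forall>\<^sub>F (n, k) in sequentially \<times>\<^sub>F sequentially. norm ((diffs ^^ r) (f (s k)) n * X (s k) ^ n) \<le> ?B n"
        unfolding eventually_prod_filter
        by (intro exI[of _ "\<lambda>_. True"] exI[of _ "\<lambda>k. \<forall>n. norm ((diffs ^^ r) (f (s k)) n * X (s k) ^ n) \<le> ?B n"]) auto
    qed auto
    then have "(\<lambda>k. der_series r (f (s k)) (X (s k))) \<longlonglongrightarrow> der_series r g x0"
      by (simp add: der_series_def)
    then show ?thesis using lim0 LIMSEQ_unique by blast
  qed
  then have g0: "g j = 0" for j
    using der_series_eq_0D[of g M x0] gM x0 by auto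
  have "\<forall>\<^sub>F k in sequentially. \<forall>j<J. \<bar>f (s k) j\<bar> < c"
  proof -
    have "\<forall>\<^sub>F k in sequentially. \<forall>j\<in>{..<J}. \<bar>f (s k) j\<bar> < c"
      using order_tendstoD(2)[OF tendsto_rabs[OF s(2)], of _ c] g0 c
      by (intro eventually_ball_finite) auto
    then show ?thesis by (rule eventually_mono) auto
  qed
  then obtain k where "\<forall>j<J. \<bar>f (s k) j\<bar> < c"
    using eventually_happens' sequentially_bot by blast
  then show False using f(2)[of "s k"] by force
qed

proposition power_series_sublevel:
  fixes x0 c M :: real
  assumes x0: "0 < x0" "x0 < 1" and c: "0 < c"
  shows "\<exists>\<epsilon> c' K. 0 < \<epsilon> \<and> 0 < c' \<and>
    (\<forall>f \<rho> \<eta>. (\<forall>j. \<bar>f j\<bar> \<le> M) \<longrightarrow> (\<exists>j<J. c \<le> \<bar>f j\<bar>) \<longrightarrow> 0 < \<rho> \<longrightarrow> \<rho> \<le> 1 \<longrightarrow> \<eta> < c' * \<rho> ^ K \<longrightarrow>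
      (\<exists>N. finite N \<and> card N \<le> 3 ^ K \<and>
        {x. \<bar>x - x0\<bar> < \<epsilon> \<and> \<bar>\<Sum>n. f n * x ^ n\<bar> \<le> \<eta>} \<subseteq> (\<Union>t\<in>N. cball t (2 * \<rho>))))"
proof -
  obtain \<epsilon>0 K where \<epsilon>0: "0 < \<epsilon>0"
    "\<And>f. \<lbrakk>\<And>j. \<bar>f j\<bar> \<le> M; \<exists>j<J. c \<le> \<bar>f j\<bar>\<rbrakk> \<Longrightarrow> \<exists>r\<le>K. \<forall>x. \<bar>x - x0\<bar> < \<epsilon>0 \<longrightarrow> \<epsilon>0 \<le> \<bar>der_series r f x\<bar>"
    using der_series_lower_bound[OF assms] by metis
  define \<epsilon> where "\<epsilon> = min \<epsilon>0 (min x0 (1 - x0))"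
  have \<epsilon>: "0 < \<epsilon>" "\<epsilon> \<le> \<epsilon>0" "\<epsilon> \<le> x0" "\<epsilon> \<le> 1 - x0" using \<epsilon>0 x0 by (auto simp: \<epsilon>_def)
  have "\<exists>N. finite N \<and> card N \<le> 3 ^ K \<and>
        {x. \<bar>x - x0\<bar> < \<epsilon> \<and> \<bar>\<Sum>n. f n * x ^ n\<bar> \<le> \<eta>} \<subseteq> (\<Union>t\<in>N. cball t (2 * \<rho>))"
    if f: "\<And>j. \<bar>f j\<bar> \<le> M" "\<exists>j<J. c \<le> \<bar>f j\<bar>" and \<rho>: "0 < \<rho>" "\<rho> \<le> 1" "\<eta> < \<epsilon>0 * \<rho> ^ K" for f \<rho> \<eta>
  proof -
    obtain r where r: "r \<le> K" "\<And>x. \<bar>x - x0\<bar> < \<epsilon>0 \<Longrightarrow> \<epsilon>0 \<le> \<bar>der_series r f x\<bar>"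
      using \<epsilon>0(2)[OF f] by blast
    have "\<exists>N. finite N \<and> card N \<le> 3 ^ r \<and>
        {x \<in> {x0 - \<epsilon> <..< x0 + \<epsilon>}. \<bar>der_series 0 f x\<bar> \<le> \<eta>} \<subseteq> (\<Union>t\<in>N. cball t (2 * \<rho>))"
    proof (rule sublevel_cover[where g = "\<lambda>i. der_series i f" and c = \<epsilon>0])
      \<comment> \<open>The order \<open>r\<close> depends on the series;
        \<open>\<rho> \<le> 1\<close> allows the uniform \<open>K\<close> in its place.\<close>
      have "\<rho> ^ K \<le> \<rho> ^ r" using \<rho> r by (intro power_decreasing) auto
      then show "\<eta> < \<epsilon>0 * \<rho> ^ r" using \<rho> \<epsilon>0(1) by (meson less_le_trans mult_left_mono less_imp_le)
      show "(der_series i f has_real_derivative der_series (Suc i) f x) (at x)"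
        if "x \<in> {x0 - \<epsilon> <..< x0 + \<epsilon>}" for i x
        using f(1) that \<epsilon> by (intro der_series_deriv[of _ M]) auto
    qed (use r \<epsilon> \<epsilon>0 \<rho> in \<open>auto simp: abs_less_iff\<close>)
    moreover have "(3::nat) ^ r \<le> 3 ^ K" using r by (intro power_increasing) auto
    moreover have "{x. \<bar>x - x0\<bar> < \<epsilon> \<and> \<bar>\<Sum>n. f n * x ^ n\<bar> \<le> \<eta>} =
        {x \<in> {x0 - \<epsilon> <..< x0 + \<epsilon>}. \<bar>der_series 0 f x\<bar> \<le> \<eta>}"
      by (auto simp: abs_less_iff der_series_def)
    ultimately show ?thesis by (metis (no_types, lifting) order_trans)
  qed
  then show ?thesis
    using \<epsilon>(1) \<epsilon>0(1)
    by (intro exI[of _ \<epsilon>] exI[of _ \<epsilon>0] exI[of _ K] conjI allI impI) (assumption | simp)+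
qed

section \<open>Dynamics when the images of long words avoid the edge lines\<close>

text \<open>Orbits have limit superior of moduli at most \<open>(1 + l) * V / (1 - l)\<close>. The
  factor 2 in place of \<open>1 + l\<close> keeps the expression simple and increasing in
  \<open>l\<close>; the summand 1 makes the eventual bound strict.\<close>

definition trap_radius :: "nat \<Rightarrow> (nat \<Rightarrow> complex) \<Rightarrow> real \<Rightarrow> real" where
  "trap_radius d u l = 2 * vertex_norm d u / (1 - l) + 1"

definition side_bound :: "nat \<Rightarrow> (nat \<Rightarrow> complex) \<Rightarrow> real \<Rightarrow> real" where
  "side_bound d u R = 2 * vertex_norm d u * (R + vertex_norm d u)"

text \<open>By \<open>side_walk\<close> the inequality says that the starting point cannot affect
  the side of any edge line on which the image lies. Only words realised in the disc are tested; the
  open ball and open cones make this a condition on a countable dense set.\<close>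

definition separated :: "nat \<Rightarrow> (nat \<Rightarrow> complex) \<Rightarrow> real \<Rightarrow> bool" where
  "separated d u l \<longleftrightarrow> (\<exists>n. \<forall>w. length w = n \<and> set w \<subseteq> {..<d} \<longrightarrow>
     (\<exists>z\<in>ball 0 (trap_radius d u l). open_itinerary d u l w z) \<longrightarrow>
     (\<forall>a<d. l ^ n * side_bound d u (trap_radius d u l) < \<bar>(1 + l) * word_sum d u a w l\<bar>))"

lemma vertex_norm_nonneg: "vertex_norm d u \<ge> 0"
  by (simp add: vertex_norm_def sum_nonneg)

lemma norm_vertex_le: "k < d \<Longrightarrow> cmod (u k) \<le> vertex_norm d u"
  unfolding vertex_norm_def by (rule member_le_sum) auto

lemma norm_step_le:
  assumes "0 < l" "k < d"
  shows "cmod (step l (u k) z) \<le> l * cmod z + (1 + l) * vertex_norm d u"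
proof -
  have "cmod (step l (u k) z) \<le> cmod (- of_real l * z) + cmod ((1 + of_real l) * u k)"
    unfolding step_def by (rule norm_triangle_ineq)
  also have "cmod (- of_real l * z) = l * cmod z" using assms by (simp add: norm_mult)
  also have "cmod ((1 + of_real l) * u k) = (1 + l) * cmod (u k)"
  proof -
    have "cmod (1 + of_real l) = \<bar>1 + l\<bar>" by (metis norm_of_real of_real_1 of_real_add)
    then show ?thesis using assms by (simp add: norm_mult)
  qed
  also have "\<dots> \<le> (1 + l) * vertex_norm d u"
    using assms norm_vertex_le[of k d u] by (intro mult_left_mono) auto
  finally show ?thesis by simp
qed

lemma abs_cross_le: "\<bar>cross a b\<bar> \<le> cmod a * cmod b"
  unfolding cross_def using abs_Im_le_cmod[of "cnj a * b"] by (simp add: norm_mult)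

lemma abs_side_le:
  assumes "a < d" "0 < d" "cmod z \<le> R"
  shows "\<bar>side d u a z\<bar> \<le> side_bound d u R"
proof -
  let ?V = "vertex_norm d u"
  have "nxt d a < d" using assms by (simp add: nxt_def)
  then have "cmod (u (nxt d a)) \<le> ?V" "cmod (u a) \<le> ?V"
    using assms norm_vertex_le by auto
  then have 1: "cmod (u (nxt d a) - u a) \<le> 2 * ?V" and 2: "cmod (z - u a) \<le> R + ?V"
    using norm_triangle_ineq4[of "u (nxt d a)" "u a"] norm_triangle_ineq4[of z "u a"] assms by linarith+
  have "\<bar>side d u a z\<bar> \<le> cmod (u (nxt d a) - u a) * cmod (z - u a)"
    unfolding side_def by (rule abs_cross_le)
  also have "\<dots> \<le> 2 * ?V * (R + ?V)"
    using 1 2 vertex_norm_nonneg[of d u] by (intro mult_mono) auto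
  finally show ?thesis by (simp add: side_bound_def)
qed

lemma walk_diff: "walk u l w z - walk u l w z' = (- of_real l) ^ length w * (z - z')"
proof (induction w arbitrary: z z')
  case (Cons k w)
  have "step l (u k) z - step l (u k) z' = - of_real l * (z - z')"
    by (simp add: step_def algebra_simps)
  then show ?case by (simp add: Cons.IH)
qed simp

text \<open>The map is discontinuous, so the limit set is obtained from shadowing alone: the orbit
  approaches a periodic orbit in phase, and that orbit is finite, hence closed.\<close>

lemma omega_limit_eq_orbit:
  assumes p: "0 < p" "(f ^^ p) q = q"
    and lim: "(\<lambda>m. dist ((f ^^ (i + m)) z) ((f ^^ m) q)) \<longlonglongrightarrow> 0"
  shows "omega_limit f z = orbit f q"
proof -
  have per: "(f ^^ (m + p * k)) q = (f ^^ m) q" for m k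
  proof -
    have "(f ^^ (p * k)) q = q"
      by (induction k) (simp_all add: funpow_add p)
    then show ?thesis by (simp add: funpow_add)
  qed
  have mod: "(f ^^ m) q = (f ^^ (m mod p)) q" for m
    using per[of "m mod p" "m div p"] by (simp add: algebra_simps)
  have "orbit f q = (\<lambda>m. (f ^^ m) q) ` {..<p}"
    unfolding orbit_def using mod p by (auto simp: image_iff) (metis lessThan_iff mod_less_divisor)
  then have clo: "closed (orbit f q)" by (simp add: finite_imp_closed)
  have small: "\<exists>M. \<forall>m\<ge>M. dist ((f ^^ (i + m)) z) ((f ^^ m) q) < e" if "e > 0" for e
    using order_tendstoD(2)[OF lim that] by (simp add: eventually_sequentially)
  show ?thesis
  proof (intro equalityI subsetI)
    fix x assume x: "x \<in> omega_limit f z"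
    have "x \<in> closure (orbit f q)"
      unfolding closure_approachable
    proof (intro allI impI)
      fix e :: real assume "e > 0"
      then obtain M where M: "\<And>m. m \<ge> M \<Longrightarrow> dist ((f ^^ (i + m)) z) ((f ^^ m) q) < e / 2"
        using small[of "e / 2"] by auto
      have "x \<in> closure {(f ^^ m) z | m. m \<ge> i + M}" using x by (auto simp: omega_limit_def)
      then obtain y where "y \<in> {(f ^^ m) z | m. m \<ge> i + M}" "dist y x < e / 2"
        using \<open>e > 0\<close> unfolding closure_approachable by (meson half_gt_zero)
      then obtain m where m: "m \<ge> i + M" "dist ((f ^^ m) z) x < e / 2" by blast
      then have "m = i + (m - i)" "m - i \<ge> M" by auto
      then have "dist ((f ^^ m) z) ((f ^^ (m - i)) q) < e / 2" using M by metis
      then have "dist ((f ^^ (m - i)) q) x < e"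
        using m dist_triangle_half_r by blast
      then show "\<exists>y\<in>orbit f q. dist y x < e" by (auto simp: orbit_def)
    qed
    then show "x \<in> orbit f q" using clo by simp
  next
    fix x assume "x \<in> orbit f q"
    then obtain m where m: "x = (f ^^ m) q" by (auto simp: orbit_def)
    show "x \<in> omega_limit f z"
      unfolding omega_limit_def
    proof (intro INT_I, unfold closure_approachable, intro allI impI)
      fix n and e :: real assume "e > 0"
      then obtain M where M: "\<And>m. m \<ge> M \<Longrightarrow> dist ((f ^^ (i + m)) z) ((f ^^ m) q) < e"
        using small[of e] by auto
      \<comment> \<open>A time with the same phase as \<open>m\<close>, beyond both \<open>M\<close>
        and \<open>n\<close>.\<close>
      let ?k = "m + p * (M + n)"
      have le: "t \<le> p * t" for t using p by simp
      have "?k \<ge> M" "i + ?k \<ge> n" using le[of "M + n"] by linarith+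
      moreover have "(f ^^ ?k) q = x" using per m by metis
      ultimately show "\<exists>y\<in>{(f ^^ m) z |m. n \<le> m}. dist y x < e"
        using M[of ?k] by (metis (mono_tags, lifting) mem_Collect_eq)
    qed
  qed
qed

text \<open>The map is prescribed on the open cones only, which separates the dynamics from the
  definition by tangent lines.\<close>

locale contracting_billiard = ccw_polygon +
  fixes l :: real and f :: "complex \<Rightarrow> complex"
  assumes l: "0 < l" "l < 1"
    and f_cone: "\<And>k z. \<lbrakk>k < d; z \<in> OC k\<rbrakk> \<Longrightarrow> f z = step l (u k) z"
begin

abbreviation "R \<equiv> trap_radius d u l"

definition regular :: "complex \<Rightarrow> bool" where
  "regular z \<longleftrightarrow> (\<forall>n. \<exists>k<d. (f ^^ n) z \<in> OC k)"

definition itin :: "complex \<Rightarrow> nat \<Rightarrow> nat" where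
  "itin z n = (SOME k. k < d \<and> (f ^^ n) z \<in> OC k)"

abbreviation word :: "complex \<Rightarrow> nat \<Rightarrow> nat \<Rightarrow> nat list" where
  "word z n N \<equiv> map (itin z) [n..<n + N]"

lemma open_cone_disjoint:
  assumes "k < d" "m < d" "z \<in> OC k" "z \<in> OC m"
  shows "k = m"
proof (rule ccontr)
  assume "k \<noteq> m"
  have "z \<in> CC k" "z \<in> CC m" using assms by (auto simp: open_cone_def closed_cone_def)
  then consider "m = nx k" | "k = nx m" using closed_cone_inter assms \<open>k \<noteq> m\<close> by blast
  then show False using assms by cases (auto simp: open_cone_def)
qed

lemma itin_cone:
  assumes "regular z"
  shows "itin z n < d" "(f ^^ n) z \<in> OC (itin z n)"
  using assms someI_ex[of "\<lambda>k. k < d \<and> (f ^^ n) z \<in> OC k"]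
  unfolding regular_def itin_def by blast+

lemma itin_eqI: "\<lbrakk>regular z; k < d; (f ^^ n) z \<in> OC k\<rbrakk> \<Longrightarrow> itin z n = k"
  using itin_cone open_cone_disjoint by blast

lemma f_itin: "regular z \<Longrightarrow> f ((f ^^ n) z) = step l (u (itin z n)) ((f ^^ n) z)"
  using f_cone itin_cone by blast

lemma walk_word:
  assumes "regular z"
  shows "walk u l (word z n N) ((f ^^ n) z) = (f ^^ (n + N)) z"
  by (induction N) (auto simp: walk_append f_itin[OF assms])

lemma open_itinerary_word:
  assumes "regular z"
  shows "open_itinerary d u l (word z n N) ((f ^^ n) z)"
  by (induction N) (auto simp: open_itinerary_append walk_word[OF assms] itin_cone[OF assms])

lemma set_word: "regular z \<Longrightarrow> set (word z n N) \<subseteq> {..<d}"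
  using itin_cone by auto

lemma word_Suc: "word z (Suc n) N = tl (word z n N @ [itin z (n + N)])"
proof -
  have "word z n N @ [itin z (n + N)] = map (itin z) [n..<Suc (n + N)]" by simp
  also have "tl \<dots> = map (itin z) [Suc n..<Suc (n + N)]"
    by (subst upt_conv_Cons) auto
  finally show ?thesis by simp
qed

lemma V_le_R: "(1 + l) * V / (1 - l) + 1 \<le> R"
  using l vertex_norm_nonneg[of d u]
  by (auto simp: trap_radius_def intro!: divide_right_mono mult_right_mono)

lemma norm_iterate_le:
  assumes "regular z"
  shows "cmod ((f ^^ n) z) \<le> l ^ n * cmod z + (1 + l) * V / (1 - l)"
proof (induction n)
  case 0
  show ?case using l vertex_norm_nonneg[of d u] by simp
next
  case (Suc n)
  have "cmod ((f ^^ Suc n) z) \<le> l * cmod ((f ^^ n) z) + (1 + l) * V"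
    using f_itin[OF assms] norm_step_le[OF l(1) itin_cone(1)[OF assms]] by simp
  also have "\<dots> \<le> l * (l ^ n * cmod z + (1 + l) * V / (1 - l)) + (1 + l) * V"
    using Suc l by (intro add_right_mono mult_left_mono) auto
  also have "\<dots> = l ^ Suc n * cmod z + (1 + l) * V / (1 - l)"
    using l by (simp add: field_simps)
  finally show ?case .
qed

lemma eventually_trapped:
  assumes "regular z"
  obtains n0 where "\<And>n. n \<ge> n0 \<Longrightarrow> cmod ((f ^^ n) z) < R"
proof -
  have "(\<lambda>n. l ^ n * cmod z) \<longlonglongrightarrow> 0"
    using l by (intro tendsto_mult_left_zero LIMSEQ_power_zero) auto
  then have "\<forall>\<^sub>F n in sequentially. l ^ n * cmod z < 1"
    by (rule order_tendstoD) simp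
  then obtain n0 where "\<And>n. n \<ge> n0 \<Longrightarrow> l ^ n * cmod z < 1"
    by (auto simp: eventually_sequentially)
  then show ?thesis
    using that[of n0] norm_iterate_le[OF assms] V_le_R by (smt (verit))
qed

lemma iterate_diff:
  assumes "regular z" "regular z'" "\<And>m. itin z (n + m) = itin z' (n' + m)"
  shows "(f ^^ (n + m)) z - (f ^^ (n' + m)) z' = (- of_real l) ^ m * ((f ^^ n) z - (f ^^ n') z')"
proof -
  have "map (itin z) [n..<n + m] = map (itin z') [n'..<n' + m]"
    using assms(3) by (intro nth_equalityI) auto
  then show ?thesis
    using walk_word[OF assms(1), of n m] walk_word[OF assms(2), of n' m]
      walk_diff[of u l "word z n m" "(f ^^ n) z" "(f ^^ n') z'"] by simp
qed

section \<open>Consequences of separation at word length \<open>N\<close>\<close>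

context
  fixes N
  assumes sep: "\<And>w a. \<lbrakk>length w = N; set w \<subseteq> {..<d};
     \<exists>z\<in>ball 0 R. open_itinerary d u l w z; a < d\<rbrakk> \<Longrightarrow>
     l ^ N * side_bound d u R < \<bar>(1 + l) * word_sum d u a w l\<bar>"
begin

text \<open>Every edge function has at the end of the word the sign of \<open>word_sum\<close>,
  whatever the start in the closed disc. Some point must realise the word, but it need not be
  \<open>z1\<close> or \<open>z2\<close>; this is what allows a limit point to be tested in
  \<open>attracted_by_periodic\<close>.\<close>

lemma cone_determined:
  assumes w: "length w = N" "set w \<subseteq> {..<d}" "\<exists>z\<in>ball 0 R. open_itinerary d u l w z"
    and z: "cmod z1 \<le> R" "cmod z2 \<le> R" and k: "k < d" "walk u l w z1 \<in> OC k"
  shows "walk u l w z2 \<in> OC k"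
proof -
  have "sgn (h a (walk u l w z)) = sgn ((1 + l) * word_sum d u a w l)" if "a < d" "cmod z \<le> R" for a z
  proof -
    have "\<bar>(- l) ^ length w * h a z\<bar> \<le> l ^ N * side_bound d u R"
      using abs_side_le[of a d z R u] that l w(1)
      by (auto simp: abs_mult power_abs intro!: mult_left_mono)
    then have "\<bar>(- l) ^ length w * h a z\<bar> < \<bar>(1 + l) * word_sum d u a w l\<bar>"
      using sep[OF w \<open>a < d\<close>] by linarith
    then show ?thesis unfolding side_walk by (auto simp: sgn_if)
  qed
  then have "sgn (h a (walk u l w z2)) = sgn (h a (walk u l w z1))" if "a < d" for a
    using that z by metis
  from this[of k] this[of "pv k"] show ?thesis
    using k by (auto simp: open_cone_def sgn_if split: if_splits)
qed

lemma itin_determined: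
  assumes reg: "regular z" "regular z'" and small: "cmod ((f ^^ n) z) < R" "cmod ((f ^^ n') z') < R"
    and eq: "word z n N = word z' n' N"
  shows "itin z (n + N) = itin z' (n' + N)"
proof -
  have "walk u l (word z n N) ((f ^^ n') z') \<in> OC (itin z (n + N))"
  proof (rule cone_determined[where ?z1.0 = "(f ^^ n) z"])
    show "\<exists>x\<in>ball 0 R. open_itinerary d u l (word z n N) x"
      using open_itinerary_word[OF reg(1), of n N] small by (intro bexI[of _ "(f ^^ n) z"]) auto
  qed (use small set_word[OF reg(1)] in \<open>auto simp: walk_word[OF reg(1)] itin_cone[OF reg(1)] less_imp_le simp del: set_map\<close>)
  then have "(f ^^ (n' + N)) z' \<in> OC (itin z (n + N))"
    unfolding eq walk_word[OF reg(2)] .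
  then show ?thesis using itin_eqI[OF reg(2) itin_cone(1)[OF reg(1)]] by simp
qed

text \<open>Equal windows of \<open>N\<close> letters have the same next letter, hence remain equal
  after sliding by one.\<close>

lemma itin_all_determined:
  assumes reg: "regular z" "regular z'"
    and small: "\<And>m. cmod ((f ^^ (n + m)) z) < R" "\<And>m. cmod ((f ^^ (n' + m)) z') < R"
    and eq: "word z n N = word z' n' N"
  shows "itin z (n + m) = itin z' (n' + m)"
proof -
  have *: "word z (n + m) N = word z' (n' + m) N" for m
  proof (induction m)
    case (Suc m)
    then show ?case
      using itin_determined[OF reg small(1)[of m] small(2)[of m]] word_Suc[of z "n + m" N] word_Suc[of z' "n' + m" N]
      by simp
  qed (use eq in simp)
  have big: "itin z (n + m) = itin z' (n' + m)" if "m \<ge> N" for m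
    using itin_determined[OF reg small(1)[of "m - N"] small(2)[of "m - N"] *] that
    by (simp add: add.assoc)
  show ?thesis
  proof (cases "m < N")
    case True
    then show ?thesis using arg_cong[OF eq, of "\<lambda>w. w ! m"] by simp
  qed (use big in simp)
qed

lemma periodic_trapped:
  assumes "regular z" "0 < p" "(f ^^ p) z = z"
  shows "cmod ((f ^^ n) z) < R"
proof -
  obtain n0 where n0: "\<And>n. n \<ge> n0 \<Longrightarrow> cmod ((f ^^ n) z) < R"
    using eventually_trapped[OF assms(1)] by blast
  have per: "(f ^^ (p * k)) z = z" for k
    by (induction k) (simp_all add: funpow_add assms)
  have "n + p * n0 \<ge> n0" using assms(2) by (simp add: trans_le_add2)
  then have "cmod ((f ^^ (n + p * n0)) z) < R" by (rule n0)
  then show ?thesis by (simp add: funpow_add per)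
qed

text \<open>The first \<open>N\<close> letters determine a periodic point: two points with the same
  letters have the same itinerary, so a common period contracts their difference and also fixes
  it.\<close>

lemma finite_periodic:
  "finite {z. regular z \<and> (\<exists>p>0. (f ^^ p) z = z)}" (is "finite ?P")
proof (rule inj_on_finite[where f = "\<lambda>z. word z 0 N" and B = "{w. set w \<subseteq> {..<d} \<and> length w = N}"])
  show "inj_on (\<lambda>z. word z 0 N) ?P"
  proof (rule inj_onI)
    fix z z' assume z: "z \<in> ?P" "z' \<in> ?P" and eq: "word z 0 N = word z' 0 N"
    then obtain p p' where p: "0 < p" "(f ^^ p) z = z" "0 < p'" "(f ^^ p') z' = z'" by auto
    have reg: "regular z" "regular z'" using z by auto
    have "itin z (0 + m) = itin z' (0 + m)" for m
      by (rule itin_all_determined[OF reg _ _ eq]) (use periodic_trapped reg p in auto)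
    from iterate_diff[OF reg this, of "p * p'"]
    have "(f ^^ (p * p')) z - (f ^^ (p * p')) z' = (- of_real l) ^ (p * p') * (z - z')" by simp
    moreover have "(f ^^ (p * k)) z = z" for k
      by (induction k) (simp_all add: funpow_add p)
    moreover have "(f ^^ (k * p')) z' = z'" for k
      by (induction k) (simp_all add: funpow_add p)
    ultimately have "z - z' = (- of_real l) ^ (p * p') * (z - z')" by simp
    then have "cmod (z - z') = cmod ((- of_real l) ^ (p * p') * (z - z'))" by (rule arg_cong)
    then have "cmod (z - z') = l ^ (p * p') * cmod (z - z')"
      using l by (simp add: norm_mult norm_power)
    moreover have "l ^ (p * p') < 1" using l p by (simp add: power_less_one_iff)
    ultimately show "z = z'" by auto
  qed
  show "finite {w. set w \<subseteq> {..<d} \<and> length w = N}" by (rule finite_lists_length_eq) simp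
qed (auto simp: itin_cone)

text \<open>By pigeonhole a window recurs, so the itinerary is eventually periodic. The orbit
  approaches the fixed point of the period word; the real issue is that this point might lie on the
  boundary of a cone, and separation excludes that.\<close>

lemma attracted_by_periodic:
  assumes reg: "regular z"
  shows "\<exists>q. regular q \<and> (\<exists>p>0. (f ^^ p) q = q) \<and> omega_limit f z = orbit f q"
proof -
  obtain n0 where n0: "\<And>n. n \<ge> n0 \<Longrightarrow> cmod ((f ^^ n) z) < R"
    using eventually_trapped[OF reg] by blast
  have "\<not> inj_on (\<lambda>n. word z n N) {n0..}"
  proof
    assume "inj_on (\<lambda>n. word z n N) {n0..}"
    moreover have "(\<lambda>n. word z n N) ` {n0..} \<subseteq> {w. set w \<subseteq> {..<d} \<and> length w = N}"
      using itin_cone[OF reg] by auto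
    moreover have "finite {w. set w \<subseteq> {..<d} \<and> length w = N}"
      by (rule finite_lists_length_eq) simp
    ultimately have "finite {n0..}" using inj_on_finite by blast
    then show False using infinite_Ici by blast
  qed
  then obtain i0 j0 where "i0 \<ge> n0" "j0 \<ge> n0" "i0 \<noteq> j0" "word z i0 N = word z j0 N"
    by (auto simp: inj_on_def)
  then obtain i j where ij: "i \<ge> n0" "i < j" "word z i N = word z j N"
    by (metis linorder_neq_iff)
  define p where "p = j - i"
  have p: "0 < p" "j = i + p" using ij by (auto simp: p_def)
  define s where "s m = itin z (i + m)" for m
  have shift: "itin z (i + m) = itin z (j + m)" for m
    using ij n0 by (intro itin_all_determined[OF reg reg]) auto
  have sp: "s (m + p) = s m" for m
    using shift[of m] by (simp add: s_def p(2) add.assoc add.commute[of m p])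
  have spk: "s (m + p * k) = s m" for m k
  proof (induction k)
    case (Suc k)
    then show ?case using sp[of "m + p * k"] by (simp add: add.assoc add.commute[of p "p * k"])
  qed simp
  define y where "y = (f ^^ i) z"
  have fy: "(f ^^ m) y = (f ^^ (i + m)) z" for m 
    by (simp add: y_def add.commute[of i] funpow_add)
  have walk_s: "walk u l (map s [m..<m + n]) ((f ^^ m) y) = (f ^^ (m + n)) y"
    "open_itinerary d u l (map s [m..<m + n]) ((f ^^ m) y)" for m n
  proof -
    have "map s [m..<m + n] = word z (i + m) n"
      by (intro nth_equalityI) (auto simp: s_def add.assoc)
    then show "walk u l (map s [m..<m + n]) ((f ^^ m) y) = (f ^^ (m + n)) y"
      "open_itinerary d u l (map s [m..<m + n]) ((f ^^ m) y)"
      using walk_word[OF reg, of "i + m" n] open_itinerary_word[OF reg, of "i + m" n]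
      by (simp_all add: fy add.assoc)
  qed
  define v where "v = map s [0..<p]"
  \<comment> \<open>The fixed point of the affine map \<open>walk u l v\<close>, whose linear part
    is \<open>(- l) ^ p\<close>.\<close>
  define q where "q = walk u l v 0 / (1 - (- of_real l) ^ p)"
  have lp: "(- complex_of_real l) ^ p \<noteq> 1"
  proof
    assume "(- complex_of_real l) ^ p = 1"
    then have "cmod ((- complex_of_real l) ^ p) = 1" by simp
    then have "l ^ p = 1" using l by (simp add: norm_power)
    moreover have "l ^ p < 1" using l p by (simp add: power_less_one_iff)
    ultimately show False by simp
  qed
  have vq: "walk u l v q = q"
  proof -
    have "walk u l v q = (- of_real l) ^ p * q + walk u l v 0"
      using walk_diff[of u l v q 0] by (simp add: v_def algebra_simps)
    also have "walk u l v 0 = q * (1 - (- of_real l) ^ p)" using lp by (simp add: q_def)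
    finally show ?thesis by (simp add: algebra_simps)
  qed
  \<comment> \<open>The orbit that \<open>q\<close> would have along the letters \<open>s\<close>;
    that it is an orbit of \<open>f\<close> follows only from \<open>QC\<close>.\<close>
  define Q where "Q m = walk u l (map s [0..<m]) q" for m
  have Q_add: "Q (m + n) = walk u l (map s [m..<m + n]) (Q m)" for m n
    by (simp add: Q_def upt_add_eq_append[of 0 m n, simplified] walk_append)
  have "Q (p + m) = Q m" for m
  proof -
    have "map s [p..<p + m] = map s [0..<m]"
      by (intro nth_equalityI) (use sp in \<open>auto simp: add.commute\<close>)
    then show ?thesis using Q_add[of p m] vq by (simp add: Q_def v_def)
  qed
  note Q_shift = this
  have Qp: "Q (m + p * k) = Q m" for m k
  proof (induction k)
    case (Suc k)
    then show ?case
      using Q_shift[of "m + p * k"] by (simp add: add.assoc add.left_commute[of p m])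
  qed simp
  have diff: "(f ^^ m) y - Q m = (- of_real l) ^ m * (y - q)" for m
    using walk_s(1)[of 0 m] walk_diff[of u l "map s [0..<m]" y q] by (simp add: Q_def)
  have lim: "(\<lambda>m. dist ((f ^^ m) y) (Q m)) \<longlonglongrightarrow> 0"
  proof -
    have "(\<lambda>m. l ^ m * cmod (y - q)) \<longlonglongrightarrow> 0"
      using l by (intro tendsto_mult_left_zero LIMSEQ_power_zero) auto
    then show ?thesis using l by (simp add: dist_norm diff norm_mult norm_power)
  qed
  have QR: "cmod (Q m) \<le> R" for m
  proof (rule field_le_epsilon)
    fix e :: real assume "e > 0"
    then obtain M where M: "\<And>m. m \<ge> M \<Longrightarrow> dist ((f ^^ m) y) (Q m) < e"
      using order_tendstoD(2)[OF lim] by (auto simp: eventually_sequentially)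
    have "m + p * M \<ge> M" using p by (simp add: trans_le_add2)
    then have "dist ((f ^^ (m + p * M)) y) (Q m) < e" using M Qp by metis
    moreover have "cmod ((f ^^ (m + p * M)) y) < R" using n0 ij by (simp add: fy)
    ultimately show "cmod (Q m) \<le> R + e"
      unfolding dist_norm using norm_triangle_ineq2[of "Q m" "(f ^^ (m + p * M)) y"]
      by (simp add: norm_minus_commute)
  qed
  have s_lt: "s m < d" for m using itin_cone[OF reg] by (simp add: s_def)
  have QC: "Q m \<in> OC (s m)" for m
  proof -
    \<comment> \<open>The cone of \<open>Q m\<close> is decided by the \<open>N\<close> letters
      before it. Shifting by the multiple \<open>p * N\<close> of the period makes room for
      them.\<close>
    define m' where "m' = m + p * N - N"
    have "N \<le> p * N" using p by simp
    then have "N \<le> m + p * N" by (rule trans_le_add2)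
    then have m': "m' + N = m + p * N" unfolding m'_def by (rule le_add_diff_inverse2)
    let ?w = "map s [m'..<m' + N]"
    have small: "cmod ((f ^^ m') y) < R" using n0 ij by (simp add: fy)
    then have adm: "\<exists>z\<in>ball 0 R. open_itinerary d u l ?w z"
      using walk_s(2)[of m' N] by (intro bexI[of _ "(f ^^ m') y"]) simp_all
    have "(f ^^ (m' + N)) y \<in> OC (s (m' + N))"
      using itin_cone(2)[OF reg, of "i + (m' + N)"] by (simp only: fy s_def)
    then have cone: "walk u l ?w ((f ^^ m') y) \<in> OC (s m)"
      unfolding walk_s(1) by (simp only: m' spk)
    have "set ?w \<subseteq> {..<d}" using s_lt by auto
    from cone_determined[OF _ this adm less_imp_le[OF small] QR s_lt cone]
    have "walk u l ?w (Q m') \<in> OC (s m)" by simp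
    then have "Q (m' + N) \<in> OC (s m)" by (simp only: Q_add)
    then show ?thesis by (simp only: m' Qp)
  qed
  have fq: "(f ^^ m) q = Q m" for m
  proof (induction m)
    case (Suc m)
    have "f (Q m) = step l (u (s m)) (Q m)" using f_cone s_lt QC by blast
    then show ?case using Suc Q_add[of m 1] by simp
  qed (simp add: Q_def)
  show ?thesis
  proof (intro exI conjI)
    show "regular q" unfolding regular_def fq using QC s_lt by blast
    show "(f ^^ p) q = q" using Qp[of 0 1] fq by (simp add: Q_def)
    then show "omega_limit f z = orbit f q"
      using lim by (intro omega_limit_eq_orbit[where i = i and p = p]) (auto simp: p fq fy)
  qed (rule p)
qed

end

theorem separated_imp_periodic:
  assumes "separated d u l"
  shows "finite {z. regular z \<and> (\<exists>p>0. (f ^^ p) z = z)}"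
    and "regular z \<Longrightarrow> \<exists>q. regular q \<and> (\<exists>p>0. (f ^^ p) q = q) \<and> omega_limit f z = orbit f q"
proof -
  obtain N where N: "\<And>w a. \<lbrakk>length w = N; set w \<subseteq> {..<d};
     \<exists>z\<in>ball 0 R. open_itinerary d u l w z; a < d\<rbrakk> \<Longrightarrow>
     l ^ N * side_bound d u R < \<bar>(1 + l) * word_sum d u a w l\<bar>"
    using assms unfolding separated_def by blast
  show "finite {z. regular z \<and> (\<exists>p>0. (f ^^ p) z = z)}"
    by (rule finite_periodic) (rule N)
  show "\<exists>q. regular q \<and> (\<exists>p>0. (f ^^ p) q = q) \<and> omega_limit f z = orbit f q" if "regular z"
    by (rule attracted_by_periodic[OF _ that]) (rule N)
qed

end

section \<open>Almost every contraction ratio\<close>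

lemma negligible_coverI:
  fixes S :: "real set"
  assumes "\<And>e. 0 < e \<Longrightarrow> \<exists>N r. finite N \<and> 0 \<le> r \<and> S \<subseteq> (\<Union>t\<in>N. cball t r) \<and> real (card N) * (2 * r) < e"
  shows "negligible S"
  unfolding negligible_outer
proof (intro allI impI)
  fix e :: real assume "e > 0"
  then obtain N r where N: "finite N" "0 \<le> r" "S \<subseteq> (\<Union>t\<in>N. cball t r)" "real (card N) * (2 * r) < e"
    using assms[OF \<open>e > 0\<close>] by metis
  have "measure lebesgue (\<Union>t\<in>N. cball t r) \<le> (\<Sum>t\<in>N. measure lebesgue (cball t r))"
    using N by (intro measure_UNION_le) auto
  also have "\<dots> = real (card N) * (2 * r)"
    using N by (simp add: cball_eq_atLeastAtMost)
  finally show "\<exists>T. S \<subseteq> T \<and> T \<in> lmeasurable \<and> measure lebesgue T < e"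
    using N by (intro exI[of _ "\<Union>t\<in>N. cball t r"]) (auto intro!: fmeasurable.finite_UN)
qed

lemma continuous_on_side [continuous_intros]:
  "continuous_on A f \<Longrightarrow> continuous_on A (\<lambda>x. side d u k (f x))"
  unfolding side_def cross_def by (intro continuous_intros)

text \<open>Closedness jointly in point and parameter: a word impossible at \<open>(z0, l0)\<close>
  is impossible nearby.\<close>

lemma closed_closed_itinerary:
  "closed {p :: complex \<times> real. closed_itinerary d u (snd p) w (fst p)}"
proof (induction w)
  case (Cons k w)
  let ?g = "\<lambda>p :: complex \<times> real. (step (snd p) (u k) (fst p), snd p)"
  have "continuous_on UNIV ?g"
    unfolding step_def by (intro continuous_intros)
  then have "closed (?g -` {p. closed_itinerary d u (snd p) w (fst p)})"
    by (rule closed_vimage[OF Cons])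
  then have 1: "closed {p. closed_itinerary d u (snd p) w (step (snd p) (u k) (fst p))}"
    by (simp add: vimage_def)
  have 2: "closed {p :: complex \<times> real. fst p \<in> closed_cone d u k}"
    unfolding closed_cone_def mem_Collect_eq
    by (intro closed_Collect_conj closed_Collect_le continuous_intros)
  show ?case
    unfolding closed_itinerary.simps by (intro closed_Collect_conj closed_Collect_const 1 2)
qed simp

lemma norm_step_diff_le:
  assumes "0 \<le> l" "k < d"
  shows "cmod (step l (u k) z - step l' (u k) z') \<le> l * cmod (z - z') + \<bar>l - l'\<bar> * (cmod z' + vertex_norm d u)"
proof -
  have "step l (u k) z - step l' (u k) z' = - of_real l * (z - z') + of_real (l - l') * (u k - z')"
    by (simp add: step_def algebra_simps)
  also have "cmod \<dots> \<le> l * cmod (z - z') + \<bar>l - l'\<bar> * cmod (u k - z')"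
    using assms norm_triangle_ineq[of "- of_real l * (z - z')" "of_real (l - l') * (u k - z')"]
    by (simp add: norm_mult del: of_real_diff)
  also have "cmod (u k - z') \<le> cmod z' + vertex_norm d u"
    using norm_triangle_ineq4[of "u k" z'] norm_vertex_le[OF assms(2), of u] by simp
  finally show ?thesis by (simp add: mult_left_mono)
qed

lemma word_sum_eq_suminf: "(\<Sum>n. word_coeff d u a w n * x ^ n) = word_sum d u a w x"
  unfolding word_sum_def by (rule suminf_finite) (auto simp: word_coeff_def)

section \<open>Word counts and null sets near a non-exceptional parameter\<close>

context ccw_polygon
begin

lemma d_pos: "0 < d" using d3 by simp

text \<open>A letter other than \<open>a\<close> and \<open>nx a\<close> contributes a nonzero
  coefficient, so each of the countably many polynomials has finitely many roots.\<close>

lemma countable_exceptional: "countable exceptional"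
proof -
  have fin: "finite {l. word_sum d u a w l = 0}"
    if a: "a < d" and w: "set w \<subseteq> {..<d}" "\<not> set w \<subseteq> {a, nx a}" for a w
  proof -
    obtain i where i: "i < length w" "rev w ! i \<notin> {a, nx a}"
      using w(2) by (metis in_set_conv_nth length_rev set_rev subsetI)
    then have "rev w ! i < d" using w(1) by (metis length_rev lessThan_iff nth_mem set_rev subsetD)
    then have "word_coeff d u a w i \<noteq> 0"
      using i h_pos[OF a, of "rev w ! i"] by (simp add: word_coeff_def)
    then have "finite {l. (\<Sum>j\<le>length w - 1. word_coeff d u a w j * l ^ j) = 0}"
      using i by (subst polyfun_finite_roots) (intro exI[of _ i], auto)
    moreover have "{..length w - 1} = {..<length w}" using i by (cases "length w") auto
    ultimately show ?thesis by (simp add: word_sum_def)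
  qed
  have eq: "exceptional = (\<Union>a\<in>{..<d}. \<Union>w\<in>{w. set w \<subseteq> {..<d} \<and> \<not> set w \<subseteq> {a, nx a}}. {l. word_sum d u a w l = 0})"
    by (auto simp: exceptional_def)
  show ?thesis unfolding eq
  proof (intro countable_UN)
    fix a w assume "a \<in> {..<d}" "w \<in> {w. set w \<subseteq> {..<d} \<and> \<not> set w \<subseteq> {a, nx a}}"
    then show "countable {l. word_sum d u a w l = 0}" using fin by (intro countable_finite) auto
  qed (auto intro: countable_finite)
qed

lemma side_vertex_gap:
  obtains c where "0 < c" "\<And>a m. \<lbrakk>a < d; m < d; m \<noteq> a; m \<noteq> nx a\<rbrakk> \<Longrightarrow> c \<le> h a (u m)"
proof -
  define A where "A = (\<lambda>(a, m). h a (u m)) ` {(a, m). a < d \<and> m < d \<and> m \<noteq> a \<and> m \<noteq> nx a}"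
  have "finite A" unfolding A_def
    by (rule finite_imageI, rule finite_subset[of _ "{..<d} \<times> {..<d}"]) auto
  moreover have "\<forall>x\<in>A. 0 < x" unfolding A_def using h_pos by auto
  ultimately show ?thesis
    by (intro that[of "Min (insert 1 A)"]) (auto simp: A_def intro!: Min_le)
qed

text \<open>Near \<open>(z0, l0)\<close> only words with a closed itinerary at
  \<open>(z0, l0)\<close> occur, as finitely many closed conditions fail for the rest. A Lebesgue
  number for the compact set \<open>cball 0 r \<times> {l0}\<close> makes the neighbourhood
  uniform.\<close>

lemma local_words:
  assumes l0: "0 < l0" "l0 \<notin> exceptional"
  obtains \<delta> where "0 < \<delta>"
    "\<And>z0. z0 \<in> cball 0 r \<Longrightarrow> \<exists>W. finite W \<and> card W \<le> 2 ^ d \<and>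
       (\<forall>z l w. dist z z0 < \<delta> \<and> \<bar>l - l0\<bar> < \<delta> \<and> 0 < l \<and> length w = m \<and> set w \<subseteq> {..<d} \<and>
          open_itinerary d u l w z \<longrightarrow> w \<in> W)"
proof -
  define words where "words = {w. set w \<subseteq> {..<d} \<and> length w = m}"
  have fin: "finite words" unfolding words_def by (rule finite_lists_length_eq) simp
  define ok where "ok U W \<longleftrightarrow> W \<subseteq> words \<and> card W \<le> 2 ^ d \<and>
      (\<forall>p\<in>U. \<forall>w\<in>words. closed_itinerary d u (snd p) w (fst p) \<longrightarrow> w \<in> W)" for U :: "(complex \<times> real) set" and W
  define \<G> where "\<G> = {U. open U \<and> (\<exists>W. ok U W)}"
  have cov: "cball 0 r \<times> {l0} \<subseteq> \<Union>\<G>"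
  proof clarify
    fix z0 :: complex
    define W where "W = {w. length w = m \<and> set w \<subseteq> {..<d} \<and> closed_itinerary d u l0 w z0}"
    define U where "U = (\<Inter>w\<in>words - W. - {p. closed_itinerary d u (snd p) w (fst p)})"
    have "open U" unfolding U_def
      using fin closed_closed_itinerary by (intro open_INT) (auto simp: open_Compl)
    moreover have "(z0, l0) \<in> U" by (auto simp: U_def W_def words_def)
    moreover have "ok U W" unfolding ok_def
    proof (intro conjI)
      show "W \<subseteq> words" by (auto simp: W_def words_def)
      show "card W \<le> 2 ^ d" unfolding W_def by (rule card_closed_itineraries[OF l0])
    qed (auto simp: U_def)
    ultimately show "(z0, l0) \<in> \<Union>\<G>" by (auto simp: \<G>_def)
  qed
  have comp: "compact (cball (0::complex) r \<times> {l0})" by (intro compact_Times) auto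
  have opn: "open G" if "G \<in> \<G>" for G using that by (simp add: \<G>_def)
  obtain \<epsilon> where \<epsilon>: "0 < \<epsilon>" "\<And>x. x \<in> cball 0 r \<times> {l0} \<Longrightarrow> \<exists>G\<in>\<G>. ball x \<epsilon> \<subseteq> G"
    using Heine_Borel_lemma[OF comp cov opn] by blast
  show ?thesis
  proof (rule that)
    show "0 < \<epsilon> / 2" using \<epsilon> by simp
    fix z0 :: complex assume "z0 \<in> cball 0 r"
    then obtain G W where G: "ball (z0, l0) \<epsilon> \<subseteq> G" "ok G W"
      using \<epsilon>(2)[of "(z0, l0)"] by (auto simp: \<G>_def)
    show "\<exists>W. finite W \<and> card W \<le> 2 ^ d \<and>
       (\<forall>z l w. dist z z0 < \<epsilon> / 2 \<and> \<bar>l - l0\<bar> < \<epsilon> / 2 \<and> 0 < l \<and> length w = m \<and> set w \<subseteq> {..<d} \<and>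
          open_itinerary d u l w z \<longrightarrow> w \<in> W)"
    proof (intro exI[of _ W] conjI allI impI)
      show "finite W" using G fin finite_subset by (auto simp: ok_def)
      show "card W \<le> 2 ^ d" using G by (auto simp: ok_def)
      fix z l w
      assume *: "dist z z0 < \<epsilon> / 2 \<and> \<bar>l - l0\<bar> < \<epsilon> / 2 \<and> 0 < l \<and> length w = m \<and> set w \<subseteq> {..<d} \<and>
          open_itinerary d u l w z"
      have "dist (z0, l0) (z, l) \<le> dist z0 z + dist l0 l"
        unfolding dist_Pair_Pair by (rule sqrt_sum_squares_le_sum) auto
      moreover have "dist z0 z < \<epsilon> / 2" "dist l0 l < \<epsilon> / 2"
        using * by (auto simp: dist_commute[of z0] dist_real_def abs_minus_commute[of l0])
      ultimately have "dist (z0, l0) (z, l) < \<epsilon>" by linarith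
      then have "(z, l) \<in> G" using G by auto
      moreover have "closed_itinerary d u l w z" using * open_itinerary_imp_closed_itinerary by blast
      moreover have "w \<in> words" using * by (auto simp: words_def)
      ultimately show "w \<in> W" using G by (auto simp: ok_def)
    qed
  qed
qed

text \<open>Each word may use its own parameter in \<open>Q\<close>, so one count serves all
  parameters near \<open>l0\<close> together.\<close>

definition adm_words :: "real set \<Rightarrow> real \<Rightarrow> nat \<Rightarrow> nat list set" where
  "adm_words Q r n = {w. set w \<subseteq> {..<d} \<and> length w = n \<and>
     (\<exists>l\<in>Q. \<exists>z\<in>cball 0 r. open_itinerary d u l w z)}"

lemma finite_adm_words: "finite (adm_words Q r n)"
  unfolding adm_words_def
  by (rule finite_subset[OF _ finite_lists_length_eq[of "{..<d}" n]]) auto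

lemma card_adm_words: "card (adm_words Q r n) \<le> d ^ n"
proof -
  have "card (adm_words Q r n) \<le> card {w. set w \<subseteq> {..<d} \<and> length w = n}"
    unfolding adm_words_def by (intro card_mono finite_lists_length_eq) auto
  then show ?thesis by (simp add: card_lists_length_eq)
qed

lemma walk_in_cball:
  assumes "0 < l" "l \<le> b" "b < 1" "2 * V / (1 - b) \<le> r" "set w \<subseteq> {..<d}" "cmod z \<le> r"
  shows "cmod (walk u l w z) \<le> r"
  using assms(5,6)
proof (induction w arbitrary: z)
  case (Cons k w)
  have r: "0 \<le> r" using Cons.prems norm_ge_zero[of z] by linarith
  have "cmod (step l (u k) z) \<le> l * cmod z + (1 + l) * V"
    using norm_step_le assms(1) Cons.prems by auto
  also have "\<dots> \<le> l * r + 2 * V"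
    using Cons.prems assms vertex_norm_nonneg[of d u] by (intro add_mono mult_mono) auto
  also have "2 * V \<le> r * (1 - b)" using assms by (simp add: field_simps)
  also have "r * (1 - b) \<le> r * (1 - l)" using assms r by (intro mult_left_mono) auto
  finally have "cmod (step l (u k) z) \<le> r" by (simp add: algebra_simps)
  then show ?case using Cons by simp
qed simp

text \<open>A step contracts the accumulated error by \<open>b\<close> and adds at most
  \<open>(r + V) * \<bar>l - l'\<bar>\<close>. The constant solves
  \<open>b * L + (r + V) = L\<close>, so it is independent of the word length.\<close>

lemma walk_param_diff:
  assumes l: "0 < l" "l \<le> b" "0 < l'" "l' \<le> b" "b < 1" and r: "2 * V / (1 - b) \<le> r"
    and w: "set w \<subseteq> {..<d}" and z: "cmod z \<le> r" "cmod z' \<le> r"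
  shows "cmod (walk u l w z - walk u l' w z') \<le> b ^ length w * cmod (z - z') + (r + V) / (1 - b) * \<bar>l - l'\<bar>"
  using w
proof (induction w rule: rev_induct)
  case Nil
  have "0 \<le> r" using z norm_ge_zero[of z] by linarith
  then show ?case using l vertex_norm_nonneg[of d u] by simp
next
  case (snoc k w)
  let ?L = "(r + V) / (1 - b)"
  let ?y = "walk u l w z" and ?y' = "walk u l' w z'"
  have IH: "cmod (?y - ?y') \<le> b ^ length w * cmod (z - z') + ?L * \<bar>l - l'\<bar>" using snoc by simp
  have y': "cmod ?y' \<le> r" using walk_in_cball[of l' b r w z'] l r z snoc by simp
  have "cmod (step l (u k) ?y - step l' (u k) ?y') \<le> l * cmod (?y - ?y') + \<bar>l - l'\<bar> * (cmod ?y' + V)"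
    using norm_step_diff_le[of l k d u] l snoc by simp
  also have "\<dots> \<le> b * (b ^ length w * cmod (z - z') + ?L * \<bar>l - l'\<bar>) + \<bar>l - l'\<bar> * (r + V)"
    using IH y' l vertex_norm_nonneg[of d u] by (intro add_mono mult_mono) auto
  also have "\<dots> = b ^ length (w @ [k]) * cmod (z - z') + (b * ?L + (r + V)) * \<bar>l - l'\<bar>"
    by (simp add: algebra_simps)
  also have "b * ?L + (r + V) = ?L" using l by (simp add: field_simps)
  finally show ?case by (simp add: walk_append)
qed

text \<open>
  The last \<open>n0\<close> letters locate the orbit point up to the Lebesgue number supplied by
  \<open>local_words\<close>, uniformly in the parameter, so only \<open>2\<^sup>d\<close> continuations of length \<open>m\<close> remain.
\<close>

lemma word_growth:
  assumes l0: "0 < l0" "l0 \<notin> exceptional" and b: "l0 < b" "b < 1" and r: "2 * V / (1 - b) \<le> r"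
  obtains \<delta> n0 where "0 < \<delta>"
    "\<And>i. card (adm_words {l. 0 < l \<and> l \<le> b \<and> \<bar>l - l0\<bar> < \<delta>} r (n0 + i * m)) \<le> d ^ n0 * (2 ^ d) ^ i"
proof -
  have r0: "0 \<le> r" 
  proof -
    have "0 \<le> 2 * V / (1 - b)" using b vertex_norm_nonneg[of d u] by simp
    then show ?thesis using r by linarith
  qed
  obtain \<epsilon> where \<epsilon>: "0 < \<epsilon>"
    "\<And>z0. z0 \<in> cball 0 r \<Longrightarrow> \<exists>W. finite W \<and> card W \<le> 2 ^ d \<and>
       (\<forall>z l w. dist z z0 < \<epsilon> \<and> \<bar>l - l0\<bar> < \<epsilon> \<and> 0 < l \<and> length w = m \<and> set w \<subseteq> {..<d} \<and>
          open_itinerary d u l w z \<longrightarrow> w \<in> W)"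
    by (rule local_words[OF l0, of r m]) blast
  define L where "L = (r + V) / (1 - b)"
  have L: "0 \<le> L" using r0 b vertex_norm_nonneg[of d u] by (simp add: L_def)
  \<comment> \<open>Two parameters in \<open>Q\<close> are less than \<open>2 * \<delta>\<close>
    apart and so displace the end of a walk by at most \<open>\<epsilon> / 2\<close>; the other half
    of \<open>\<epsilon>\<close> is for the choice of starting point, through
    \<open>n0\<close>.\<close>
  define \<delta> where "\<delta> = min \<epsilon> (\<epsilon> / (4 * (L + 1)))"
  have \<delta>: "0 < \<delta>" "\<delta> \<le> \<epsilon>" using \<epsilon> L by (auto simp: \<delta>_def)
  have "(L + 1) * \<delta> \<le> (L + 1) * (\<epsilon> / (4 * (L + 1)))"
    using L by (intro mult_left_mono) (auto simp: \<delta>_def)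
  also have "\<dots> = \<epsilon> / 4" using L by (simp add: field_simps)
  finally have "L * (2 * \<delta>) \<le> \<epsilon> / 2" using \<delta> by (simp add: algebra_simps)
  have "(\<lambda>n. b ^ n * (2 * r)) \<longlonglongrightarrow> 0"
    using b l0 by (intro tendsto_mult_left_zero LIMSEQ_power_zero) auto
  then have "\<forall>\<^sub>F n in sequentially. b ^ n * (2 * r) < \<epsilon> / 2"
    by (rule order_tendstoD) (use \<epsilon> in simp)
  then obtain n0 where n0: "\<And>n. n \<ge> n0 \<Longrightarrow> b ^ n * (2 * r) < \<epsilon> / 2"
    by (auto simp: eventually_sequentially)
  define Q where "Q = {l. 0 < l \<and> l \<le> b \<and> \<bar>l - l0\<bar> < \<delta>}"
  \<comment> \<open>All realisations of a prefix end within \<open>\<epsilon>\<close> of one of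
    them, \<open>y1\<close>, so the at most \<open>2 ^ d\<close> words near \<open>y1\<close> are
    the only continuations.\<close>
  have step: "card (adm_words Q r (n + m)) \<le> card (adm_words Q r n) * 2 ^ d" if n: "n \<ge> n0" for n
  proof -
    have "\<exists>W. finite W \<and> card W \<le> 2 ^ d \<and> (\<forall>x. length x = m \<and> v @ x \<in> adm_words Q r (n + m) \<longrightarrow> x \<in> W)"
      if v: "v \<in> adm_words Q r n" for v
    proof -
      obtain l1 z1 where 1: "l1 \<in> Q" "cmod z1 \<le> r" and v': "length v = n" "set v \<subseteq> {..<d}"
        using v by (auto simp: adm_words_def)
      define y1 where "y1 = walk u l1 v z1"
      have "y1 \<in> cball 0 r" using walk_in_cball[of l1 b r v z1] 1 v' r b by (simp add: y1_def Q_def)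
      from \<epsilon>(2)[OF this] obtain W where W0: "finite W" "card W \<le> 2 ^ d"
        "\<forall>z l w. dist z y1 < \<epsilon> \<and> \<bar>l - l0\<bar> < \<epsilon> \<and> 0 < l \<and> length w = m \<and> set w \<subseteq> {..<d} \<and>
          open_itinerary d u l w z \<longrightarrow> w \<in> W"
        by (elim exE conjE)
      note W = W0(1,2) W0(3)[rule_format, OF conjI, OF _ conjI, OF _ _ conjI, OF _ _ _ conjI, OF _ _ _ _ conjI]
      have "x \<in> W" if x: "length x = m" "v @ x \<in> adm_words Q r (n + m)" for x
      proof -
        obtain l z where z: "l \<in> Q" "cmod z \<le> r" "open_itinerary d u l (v @ x) z" "set x \<subseteq> {..<d}"
          using x by (auto simp: adm_words_def)
        have "cmod (walk u l v z - y1) \<le> b ^ n * cmod (z - z1) + L * \<bar>l - l1\<bar>"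
          using walk_param_diff[of l b l1 r v z z1] z 1 v' b r by (simp add: Q_def L_def y1_def)
        also have "\<dots> \<le> b ^ n * (2 * r) + L * (2 * \<delta>)"
          using z 1 L b l0 norm_triangle_ineq4[of z z1]
          by (intro add_mono mult_left_mono) (auto simp: Q_def)
        also have "\<dots> < \<epsilon>" using n0[OF n] \<open>L * (2 * \<delta>) \<le> \<epsilon> / 2\<close> by simp
        finally show "x \<in> W"
          using z x \<delta> by (intro W(3)[of "walk u l v z" l]) (auto simp: open_itinerary_append dist_norm Q_def)
      qed
      then show ?thesis using W by blast
    qed
    then have "\<forall>v\<in>adm_words Q r n. \<exists>W. finite W \<and> card W \<le> 2 ^ d \<and>
        (\<forall>x. length x = m \<and> v @ x \<in> adm_words Q r (n + m) \<longrightarrow> x \<in> W)"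
      by blast
    from bchoice[OF this] obtain W where W: "\<And>v. v \<in> adm_words Q r n \<Longrightarrow> finite (W v) \<and> card (W v) \<le> 2 ^ d \<and>
        (\<forall>x. length x = m \<and> v @ x \<in> adm_words Q r (n + m) \<longrightarrow> x \<in> W v)"
      by blast
    have "adm_words Q r (n + m) \<subseteq> (\<lambda>(v, x). v @ x) ` (SIGMA v:adm_words Q r n. W v)"
    proof
      fix w assume w: "w \<in> adm_words Q r (n + m)"
      have "open_itinerary d u l (take n w) z" if "open_itinerary d u l w z" for l z
        using open_itinerary_append[of d u l "take n w" "drop n w" z] that by simp
      then have tv: "take n w \<in> adm_words Q r n"
        using w set_take_subset[of n w] unfolding adm_words_def by auto
      moreover have "drop n w \<in> W (take n w)"
      proof -
        have "length (drop n w) = m" "take n w @ drop n w \<in> adm_words Q r (n + m)"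
          using w by (auto simp: adm_words_def)
        then show ?thesis using W[OF tv] by blast
      qed
      ultimately show "w \<in> (\<lambda>(v, x). v @ x) ` (SIGMA v:adm_words Q r n. W v)"
        by (intro image_eqI[of _ _ "(take n w, drop n w)"]) auto
    qed
    then have "card (adm_words Q r (n + m)) \<le> card (SIGMA v:adm_words Q r n. W v)"
      using W finite_adm_words by (intro surj_card_le) auto
    also have "\<dots> = (\<Sum>v\<in>adm_words Q r n. card (W v))"
      using W finite_adm_words by (intro card_SigmaI) auto
    also have "\<dots> \<le> card (adm_words Q r n) * 2 ^ d"
      using W sum_bounded_above[of "adm_words Q r n" "\<lambda>v. card (W v)" "2 ^ d"] by simp
    finally show ?thesis .
  qed
  show ?thesis
  proof (rule that[OF \<delta>(1)])
    fix i
    have "card (adm_words Q r (n0 + i * m)) \<le> d ^ n0 * (2 ^ d) ^ i"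
    proof (induction i)
      case 0
      then show ?case using card_adm_words[of Q r n0] by simp
    next
      case (Suc i)
      have "card (adm_words Q r (n0 + Suc i * m)) = card (adm_words Q r ((n0 + i * m) + m))"
        by (simp add: algebra_simps)
      also have "\<dots> \<le> card (adm_words Q r (n0 + i * m)) * 2 ^ d" by (rule step) simp
      also have "\<dots> \<le> d ^ n0 * (2 ^ d) ^ i * 2 ^ d" using Suc by simp
      finally show ?case by (simp add: mult_ac)
    qed
    then show "card (adm_words {l. 0 < l \<and> l \<le> b \<and> \<bar>l - l0\<bar> < \<delta>} r (n0 + i * m)) \<le> d ^ n0 * (2 ^ d) ^ i"
      by (simp add: Q_def)
  qed
qed

text \<open>By \<open>short_runs\<close> a long run would push the positive gap \<open>c\<close>
  below \<open>b ^ (2 * j)\<close> times a bound valid on the disc. The result is uniform in the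
  parameter and later yields a coefficient bounded away from 0.\<close>

lemma run_bound:
  assumes b: "0 < b" "b < 1"
  obtains J where "\<And>l a q y. \<lbrakk>0 < l; l \<le> b; a < d; set q \<subseteq> {..<d}; length q = J;
      cmod y \<le> r; open_itinerary d u l q y\<rbrakk> \<Longrightarrow> \<not> set q \<subseteq> {a, nx a}"
proof -
  obtain c where c: "0 < c" "\<And>a m. \<lbrakk>a < d; m < d; m \<noteq> a; m \<noteq> nx a\<rbrakk> \<Longrightarrow> c \<le> h a (u m)"
    by (rule side_vertex_gap) (rule that; blast)
  define r' where "r' = \<bar>r\<bar> + 2 * V"
  let ?B = "side_bound d u V + side_bound d u r'"
  have "(\<lambda>n. (b\<^sup>2) ^ n * ?B) \<longlonglongrightarrow> 0"
    using b by (intro tendsto_mult_left_zero LIMSEQ_power_zero) (auto simp: power_less_one_iff abs_square_less_1)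
  then have "\<forall>\<^sub>F n in sequentially. (b\<^sup>2) ^ n * ?B < c" by (rule order_tendstoD) (rule c)
  then obtain j where j: "b ^ (2 * j) * ?B < c"
    by (auto simp: eventually_sequentially power_mult)
  have main: False if l: "0 < l" "l \<le> b" and a: "a < d" and q: "set q \<subseteq> {a, nx a}" "length q = 2 * j + 1" "hd q = a"
    "closed_itinerary d u l q y" "cmod y \<le> r'" for l a q y
  proof -
    let ?D = "h (pv a) (u (nx a))"
    have "0 \<le> r'" using vertex_norm_nonneg[of d u] by (simp add: r'_def)
    have "?D \<le> l ^ (2 * j) * (?D - h (pv a) y)"
      using short_runs[of l a q j y] l a q by simp
    also have "\<dots> \<le> l ^ (2 * j) * ?B"
      using abs_side_le[of "pv a" d "u (nx a)" V u] abs_side_le[of "pv a" d y r' u] q d_pos l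
        norm_vertex_le[of "nx a" d u]
      by (intro mult_left_mono) (auto simp: abs_le_iff)
    also have "\<dots> \<le> b ^ (2 * j) * ?B"
      using l vertex_norm_nonneg[of d u] \<open>0 \<le> r'\<close> by (intro mult_right_mono power_mono) (auto simp: side_bound_def)
    finally have "?D < c" using j by simp
    moreover have "c \<le> ?D" using a by (intro c(2)) auto
    ultimately show False by simp
  qed
  show ?thesis
  \<comment> \<open>One letter to spare: dropping the last letter, or the first one if the run
    begins with \<open>nx a\<close>, leaves an odd run beginning with \<open>a\<close>. The radius
    \<open>r'\<close> allows for the step taken in the second case.\<close>
  proof (rule that[of "2 * j + 2"], rule notI)
    fix l a q y
    assume l: "0 < l" "l \<le> b" and a: "a < d" and q: "set q \<subseteq> {..<d}" "length q = 2 * j + 2"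
      and y: "cmod y \<le> r" "open_itinerary d u l q y" and sub: "set q \<subseteq> {a, nx a}"
    have cl: "closed_itinerary d u l q y" using open_itinerary_imp_closed_itinerary l q y by blast
    obtain x q' where xq: "q = x # q'" using q by (cases q) auto
    show False
    proof (cases "x = a")
      case True
      have "q = butlast q @ [last q]" using xq by simp
      then have "closed_itinerary d u l (butlast q) y"
        using cl closed_itinerary_appendD(1) by metis
      moreover have "hd (butlast q) = a" using xq True q by (cases q') auto
      moreover have "set (butlast q) \<subseteq> {a, nx a}" using sub by (meson in_set_butlastD subset_iff)
      moreover have "length (butlast q) = 2 * j + 1" using q by simp
      moreover have "cmod y \<le> r'" using y vertex_norm_nonneg[of d u] by (simp add: r'_def)
      ultimately show False using main[OF l a] by blast
    next
      case False
      then have x: "x = nx a" using sub xq by auto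
      have "q' \<noteq> []" using q xq by auto
      then have "hd q' = a" using cl xq x sub by (cases q') auto
      moreover have "cmod (step l (u x) y) \<le> r'"
      proof -
        have "cmod (step l (u x) y) \<le> l * cmod y + (1 + l) * V"
          using norm_step_le[of l x d u y] l q xq by auto
        also have "\<dots> \<le> 1 * \<bar>r\<bar> + 2 * V"
          using l b y vertex_norm_nonneg[of d u] by (intro add_mono mult_mono) auto
        finally show ?thesis by (simp add: r'_def)
      qed
      ultimately show False
        using main[OF l a, of q' "step l (u x) y"] q xq sub cl by auto
    qed
  qed
qed

text \<open>At length \<open>n0 + i * m\<close>, failure of separation puts the parameter into a
  sublevel set of one of at most \<open>d ^ n0 * (2 ^ d) ^ i * d\<close> series. Each set is covered
  by \<open>3 ^ K\<close> balls of radius proportional to \<open>b ^ (s * i)\<close>, so the total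
  length is of order \<open>(b ^ s * 2 ^ d) ^ i\<close>.\<close>

lemma separated_locally_null:
  assumes l0: "0 < l0" "l0 < 1" "l0 \<notin> exceptional"
  shows "\<exists>\<delta>>0. negligible {l. \<bar>l - l0\<bar> < \<delta> \<and> \<not> separated d u l}"
proof -
  define b where "b = (1 + l0) / 2"
  have b: "l0 < b" "b < 1" "0 < b" using l0 by (auto simp: b_def)
  define r where "r = trap_radius d u b"
  have rV: "2 * V / (1 - b) \<le> r" by (simp add: r_def trap_radius_def)
  obtain J where J: "\<And>l a q y. \<lbrakk>0 < l; l \<le> b; a < d; set q \<subseteq> {..<d}; length q = J;
      cmod y \<le> r; open_itinerary d u l q y\<rbrakk> \<Longrightarrow> \<not> set q \<subseteq> {a, nx a}"
    by (rule run_bound[OF b(3,2), of r]) (rule that, blast)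
  obtain c where c: "0 < c" "\<And>a m. \<lbrakk>a < d; m < d; m \<noteq> a; m \<noteq> nx a\<rbrakk> \<Longrightarrow> c \<le> h a (u m)"
    by (rule side_vertex_gap) (rule that; blast)
  define M where "M = side_bound d u V"
  obtain \<epsilon> c' K where \<epsilon>: "0 < \<epsilon>" and c': "0 < c'" and
    sub: "\<forall>f \<rho> \<eta>. (\<forall>j. \<bar>f j\<bar> \<le> M) \<longrightarrow> (\<exists>j<J. c \<le> \<bar>f j\<bar>) \<longrightarrow> 0 < \<rho> \<longrightarrow> \<rho> \<le> 1 \<longrightarrow> \<eta> < c' * \<rho> ^ K \<longrightarrow>
      (\<exists>N. finite N \<and> card N \<le> 3 ^ K \<and>
        {x. \<bar>x - l0\<bar> < \<epsilon> \<and> \<bar>\<Sum>n. f n * x ^ n\<bar> \<le> \<eta>} \<subseteq> (\<Union>t\<in>N. cball t (2 * \<rho>)))"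
    using power_series_sublevel[OF l0(1,2) c(1), of M J] by (elim exE conjE)
  have "(\<lambda>s. b ^ s * 2 ^ d) \<longlonglongrightarrow> 0"
    using b by (intro tendsto_mult_left_zero LIMSEQ_power_zero) auto
  then have "\<forall>\<^sub>F s in sequentially. b ^ s * 2 ^ d < 1 / 2" by (rule order_tendstoD) simp
  then obtain s where s: "b ^ s * 2 ^ d \<le> 1 / 2" "1 \<le> s"
  proof -
    from \<open>\<forall>\<^sub>F s in sequentially. b ^ s * 2 ^ d < 1 / 2\<close>
    have "\<forall>\<^sub>F s in sequentially. b ^ s * 2 ^ d < 1 / 2 \<and> 1 \<le> s"
      using eventually_ge_at_top[of "1::nat"] by eventually_elim auto
    then obtain s where "b ^ s * 2 ^ d < 1 / 2 \<and> 1 \<le> s"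
      using eventually_happens' sequentially_bot by blast
    then show ?thesis using that[of s] by simp
  qed
  \<comment> \<open>A block of \<open>m\<close> letters lowers the sublevel height by
    \<open>(b ^ s) ^ Suc K\<close>, which permits \<open>\<rho>\<close> to shrink by
    \<open>b ^ s\<close>. With \<open>Suc K\<close> the block is nonempty even for
    \<open>K = 0\<close>.\<close>
  define m where "m = s * Suc K"
  obtain \<delta>0 n0 where \<delta>0: "0 < \<delta>0" and
    grow: "\<And>i. card (adm_words {l. 0 < l \<and> l \<le> b \<and> \<bar>l - l0\<bar> < \<delta>0} r (n0 + i * m)) \<le> d ^ n0 * (2 ^ d) ^ i"
    by (rule word_growth[OF l0(1,3) b(1,2) rV, of m]) (rule that; blast)
  define \<delta> where "\<delta> = min (min \<delta>0 \<epsilon>) (min l0 (b - l0))"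
  have \<delta>: "0 < \<delta>" "\<delta> \<le> \<delta>0" "\<delta> \<le> \<epsilon>" "\<delta> \<le> l0" "\<delta> \<le> b - l0"
    using \<delta>0 \<epsilon> l0 b by (auto simp: \<delta>_def)
  define Q where "Q = {l. 0 < l \<and> l \<le> b \<and> \<bar>l - l0\<bar> < \<delta>0}"
  define S where "S = {l. \<bar>l - l0\<bar> < \<delta> \<and> \<not> separated d u l}"
  define H where "H = side_bound d u r"
  have r0: "0 \<le> r" using b vertex_norm_nonneg[of d u] by (simp add: r_def trap_radius_def)
  have H0: "0 \<le> H" using r0 vertex_norm_nonneg[of d u] by (simp add: H_def side_bound_def)
  \<comment> \<open>Chosen so that \<open>H < c' * C\<close>; since \<open>C\<close> is at least 1,
    raising it to the power \<open>Suc K\<close> does no harm.\<close>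
  define C where "C = H / c' + 1"
  have C1: "1 \<le> C" using H0 c' by (simp add: C_def)
  define \<rho> where "\<rho> i = b ^ (s * i) * C" for i
  have \<rho>0: "0 < \<rho> i" for i using b C1 by (simp add: \<rho>_def)
  have \<eta>: "b ^ (n0 + i * m) * H < c' * \<rho> i ^ K" if "\<rho> i \<le> 1" for i
  proof -
    have "b ^ (n0 + i * m) * H \<le> b ^ (i * m) * H"
      using b H0 by (intro mult_right_mono power_decreasing) auto
    also have "H < c' * C" using c' by (simp add: C_def field_simps)
    then have "b ^ (i * m) * H < b ^ (i * m) * (c' * C)" using b by simp
    also have "C \<le> C ^ Suc K" using C1 by (rule self_le_power) simp
    then have "b ^ (i * m) * (c' * C) \<le> b ^ (i * m) * (c' * C ^ Suc K)"
      using b c' by (intro mult_left_mono) auto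
    also have "\<dots> = c' * \<rho> i ^ Suc K"
      unfolding \<rho>_def m_def power_mult_distrib power_mult[symmetric] by (simp add: mult_ac)
    also have "\<dots> \<le> c' * \<rho> i ^ K"
      using that \<rho>0[of i] c' by (intro mult_left_mono power_decreasing) auto
    finally show ?thesis .
  qed
  have cover: "\<exists>N. finite N \<and> real (card N) * (2 * (2 * \<rho> i)) \<le> real d ^ n0 * real d * 3 ^ K * (4 * C) * (1 / 2) ^ i \<and>
      S \<subseteq> (\<Union>t\<in>N. cball t (2 * \<rho> i))" if i: "\<rho> i \<le> 1" "J \<le> i" for i
  proof -
    define n where "n = n0 + i * m"
    have "1 \<le> m" using s by (simp add: m_def)
    then have "i * 1 \<le> i * m" by (rule mult_le_mono2)
    then have nJ: "J \<le> n" using i unfolding n_def by linarith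
    define D where "D = adm_words Q r n \<times> {..<d}"
    define E where "E = (\<lambda>(w, a). {x. \<bar>x - l0\<bar> < \<epsilon> \<and> \<bar>\<Sum>j. word_coeff d u a w j * x ^ j\<bar> \<le> b ^ n * H})"
    have "\<exists>N. finite N \<and> card N \<le> 3 ^ K \<and> E p \<subseteq> (\<Union>t\<in>N. cball t (2 * \<rho> i))" if "p \<in> D" for p
    proof -
      obtain w a where p: "p = (w, a)" "w \<in> adm_words Q r n" "a < d"
        using \<open>p \<in> D\<close> by (auto simp: D_def)
      obtain l z where l: "0 < l" "l \<le> b" "cmod z \<le> r" "open_itinerary d u l w z"
        and w: "set w \<subseteq> {..<d}" "length w = n"
        using p by (auto simp: adm_words_def Q_def)
      have rev_lt: "rev w ! j < d" if "j < n" for j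
        using that w by (metis length_rev lessThan_iff nth_mem set_rev subsetD)
      have "\<exists>N. finite N \<and> card N \<le> 3 ^ K \<and>
        {x. \<bar>x - l0\<bar> < \<epsilon> \<and> \<bar>\<Sum>j. word_coeff d u a w j * x ^ j\<bar> \<le> b ^ n * H} \<subseteq> (\<Union>t\<in>N. cball t (2 * \<rho> i))"
      proof (rule sub[rule_format])
        show "\<bar>word_coeff d u a w j\<bar> \<le> M" for j
        proof (cases "j < n")
          case True
          then show ?thesis
            using abs_side_le[OF p(3) d_pos norm_vertex_le[OF rev_lt[OF True]], of u] w
            by (simp add: word_coeff_def abs_mult power_abs M_def)
        next
          case False
          then show ?thesis
            using w vertex_norm_nonneg[of d u] by (simp add: word_coeff_def M_def side_bound_def)
        qed
        \<comment> \<open>\<open>word_coeff\<close> reads the word backwards, so the last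
          \<open>J\<close> letters carry the coefficients of index below \<open>J\<close>. They
          start inside the disc by \<open>walk_in_cball\<close>, and \<open>run_bound\<close>
          applies.\<close>
        let ?p = "take (n - J) w" and ?q = "drop (n - J) w"
        have "open_itinerary d u l ?q (walk u l ?p z)"
          using open_itinerary_append[of d u l ?p ?q z] l by simp
        moreover have "set ?p \<subseteq> {..<d}" "set ?q \<subseteq> {..<d}"
          using w set_take_subset[of "n - J" w] set_drop_subset[of "n - J" w] by auto
        moreover from this have "cmod (walk u l ?p z) \<le> r"
          using walk_in_cball[OF l(1,2) b(2) rV _ l(3)] by blast
        ultimately have "\<not> set ?q \<subseteq> {a, nx a}"
          using w nJ by (intro J[OF l(1,2) p(3), of ?q "walk u l ?p z"]) auto
        then obtain x where "x \<in> set (rev ?q)" "x \<noteq> a" "x \<noteq> nx a" by auto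
        moreover from this(1) obtain j where "j < length (rev ?q)" "rev ?q ! j = x"
          unfolding in_set_conv_nth by blast
        moreover have "length (rev ?q) = J" using w nJ by simp
        ultimately have j: "j < J" "rev ?q ! j \<noteq> a" "rev ?q ! j \<noteq> nx a" by simp_all
        have "rev ?q ! j = rev w ! j" using j w nJ by (simp add: rev_nth)
        moreover have "j < n" using j nJ by simp
        ultimately have "c \<le> \<bar>word_coeff d u a w j\<bar>"
          using c(2)[OF p(3) rev_lt[of j]] j w by (simp add: word_coeff_def abs_mult power_abs)
        then show "\<exists>j<J. c \<le> \<bar>word_coeff d u a w j\<bar>" using j by blast
        show "b ^ n * H < c' * \<rho> i ^ K" unfolding n_def by (rule \<eta>[OF i(1)])
      qed (use \<rho>0 i in auto)
      then show ?thesis by (simp add: p E_def)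
    qed
    then have "\<forall>p\<in>D. \<exists>N. finite N \<and> card N \<le> 3 ^ K \<and> E p \<subseteq> (\<Union>t\<in>N. cball t (2 * \<rho> i))" by blast
    from bchoice[OF this] obtain N where N: "\<forall>p\<in>D. finite (N p) \<and> card (N p) \<le> 3 ^ K \<and> E p \<subseteq> (\<Union>t\<in>N p. cball t (2 * \<rho> i))"
      by (elim exE)
    have finD: "finite D" by (simp add: D_def finite_adm_words)
    have "card (adm_words Q r n) \<le> d ^ n0 * (2 ^ d) ^ i" using grow[of i] by (simp add: Q_def n_def)
    then have "card D \<le> d ^ n0 * (2 ^ d) ^ i * d" by (simp add: D_def card_cartesian_product)
    moreover have "card (\<Union>p\<in>D. N p) \<le> (\<Sum>p\<in>D. card (N p))" by (rule card_UN_le[OF finD])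
    moreover have "(\<Sum>p\<in>D. card (N p)) \<le> card D * 3 ^ K"
      using sum_bounded_above[of D "\<lambda>p. card (N p)" "3 ^ K"] N by simp
    ultimately have "card (\<Union>p\<in>D. N p) \<le> d ^ n0 * (2 ^ d) ^ i * d * 3 ^ K"
      by (meson le_trans mult_le_mono1)
    then have "real (card (\<Union>p\<in>D. N p)) \<le> real (d ^ n0 * (2 ^ d) ^ i * d * 3 ^ K)"
      by (rule of_nat_mono)
    then have "real (card (\<Union>p\<in>D. N p)) * (2 * (2 * \<rho> i)) \<le> real (d ^ n0 * (2 ^ d) ^ i * d * 3 ^ K) * (2 * (2 * \<rho> i))"
      using \<rho>0[of i] by (intro mult_right_mono) auto
    also have "\<dots> = real d ^ n0 * real d * 3 ^ K * (4 * C) * (b ^ s * 2 ^ d) ^ i"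
    proof -
      have "\<rho> i = (b ^ s) ^ i * C" by (simp add: \<rho>_def power_mult)
      then show ?thesis by (simp add: power_mult_distrib mult_ac)
    qed
    also have "\<dots> \<le> real d ^ n0 * real d * 3 ^ K * (4 * C) * (1 / 2) ^ i"
      using s b C1 by (intro mult_left_mono power_mono) auto
    finally have card: "real (card (\<Union>p\<in>D. N p)) * (2 * (2 * \<rho> i)) \<le> real d ^ n0 * real d * 3 ^ K * (4 * C) * (1 / 2) ^ i" .
    have "S \<subseteq> (\<Union>p\<in>D. E p)"
    proof
      fix l assume "l \<in> S"
      then have l: "0 < l" "l \<le> b" "\<bar>l - l0\<bar> < \<epsilon>" "l \<in> Q" "\<not> separated d u l"
        using \<delta> by (auto simp: S_def Q_def)
      define B where "B = side_bound d u (trap_radius d u l)"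
      \<comment> \<open>Failure of \<open>separated\<close> yields a bad word and edge for every
        length, in particular for \<open>n\<close>.\<close>
      obtain w a where w: "length w = n" "set w \<subseteq> {..<d}" "a < d"
        "\<exists>z\<in>ball 0 (trap_radius d u l). open_itinerary d u l w z"
        "\<not> l ^ n * B < \<bar>(1 + l) * word_sum d u a w l\<bar>"
        using l(5) unfolding separated_def B_def by blast
      have rle: "trap_radius d u l \<le> r"
        unfolding r_def trap_radius_def using l b vertex_norm_nonneg[of d u]
        by (intro add_right_mono divide_left_mono) auto
      then have "B \<le> H"
        unfolding B_def H_def side_bound_def using vertex_norm_nonneg[of d u]
        by (intro mult_left_mono) auto
      moreover have "0 \<le> B" using l b vertex_norm_nonneg[of d u]
        by (auto simp: B_def side_bound_def trap_radius_def intro!: mult_nonneg_nonneg add_nonneg_nonneg divide_nonneg_nonneg)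
      ultimately have "l ^ n * B \<le> b ^ n * H" using l by (intro mult_mono power_mono) auto
      moreover have "\<bar>word_sum d u a w l\<bar> \<le> \<bar>(1 + l) * word_sum d u a w l\<bar>"
        using l by (simp add: abs_mult mult_right_mono[of 1 "1 + l"] mult_le_cancel_right1)
      ultimately have "\<bar>word_sum d u a w l\<bar> \<le> b ^ n * H" using w(5) by linarith
      then have "l \<in> E (w, a)" using l by (simp add: E_def word_sum_eq_suminf)
      moreover have "(w, a) \<in> D"
        using w l rle by (fastforce simp: D_def adm_words_def)
      ultimately show "l \<in> (\<Union>p\<in>D. E p)" by blast
    qed
    also have "\<dots> \<subseteq> (\<Union>t\<in>(\<Union>p\<in>D. N p). cball t (2 * \<rho> i))"
      using N by (simp only: UN_UN_flatten) (intro UN_mono order_refl, blast)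
    finally show ?thesis using card finD N by (intro exI[of _ "\<Union>p\<in>D. N p"]) auto
  qed
  have "negligible S"
  proof (rule negligible_coverI)
    fix e :: real assume "0 < e"
    have "(\<lambda>i. real d ^ n0 * real d * 3 ^ K * (4 * C) * (1 / 2) ^ i) \<longlonglongrightarrow> 0"
      by (intro tendsto_mult_right_zero LIMSEQ_power_zero) auto
    then have 1: "\<forall>\<^sub>F i in sequentially. real d ^ n0 * real d * 3 ^ K * (4 * C) * (1 / 2) ^ i < e"
      by (rule order_tendstoD) fact
    have "b ^ s < 1" using b s by (simp add: power_less_one_iff)
    then have "(\<lambda>i. \<rho> i) \<longlonglongrightarrow> 0"
      unfolding \<rho>_def power_mult using b by (intro tendsto_mult_left_zero LIMSEQ_power_zero) auto
    then have 2: "\<forall>\<^sub>F i in sequentially. \<rho> i < 1" by (rule order_tendstoD) simp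
    have "\<forall>\<^sub>F i in sequentially. real d ^ n0 * real d * 3 ^ K * (4 * C) * (1 / 2) ^ i < e \<and> \<rho> i < 1 \<and> J \<le> i"
      using 1 2 eventually_ge_at_top[of J] by eventually_elim auto
    then obtain i where i: "real d ^ n0 * real d * 3 ^ K * (4 * C) * (1 / 2) ^ i < e" "\<rho> i \<le> 1" "J \<le> i"
      using eventually_happens' sequentially_bot by (metis (no_types, lifting) less_imp_le)
    from cover[OF i(2,3)] obtain N where "finite N"
      "real (card N) * (2 * (2 * \<rho> i)) \<le> real d ^ n0 * real d * 3 ^ K * (4 * C) * (1 / 2) ^ i"
      "S \<subseteq> (\<Union>t\<in>N. cball t (2 * \<rho> i))" by (elim exE conjE)
    then show "\<exists>N r. finite N \<and> 0 \<le> r \<and> S \<subseteq> (\<Union>t\<in>N. cball t r) \<and> real (card N) * (2 * r) < e"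
      using i(1) \<rho>0[of i] by (intro exI[of _ N] exI[of _ "2 * \<rho> i"]) auto
  qed
  then show ?thesis using \<delta>(1) unfolding S_def by (intro exI[of _ \<delta>] conjI)
qed

text \<open>Locally negligible sets are negligible, and a Borel null set \<open>Z\<close> around the
  exceptional parameters' complement in the bad set transfers this from Lebesgue to Borel
  measure.\<close>

theorem AE_separated: "AE l in lborel. l \<in> {0<..<1} \<longrightarrow> separated d u l"
proof -
  define T where "T = {l. 0 < l \<and> l < 1 \<and> l \<notin> exceptional \<and> \<not> separated d u l}"
  have "negligible T"
  proof (rule locally_negligible_alt[THEN iffD2], rule ballI)
    fix x assume "x \<in> T"
    then have "\<exists>\<delta>>0. negligible {l. \<bar>l - x\<bar> < \<delta> \<and> \<not> separated d u l}"
      by (intro separated_locally_null) (auto simp: T_def)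
    then obtain \<delta> where \<delta>: "\<delta> > 0" "negligible {l. \<bar>l - x\<bar> < \<delta> \<and> \<not> separated d u l}"
      by (elim exE conjE)
    show "\<exists>U. openin (top_of_set T) U \<and> x \<in> U \<and> negligible U"
    proof (intro exI[of _ "T \<inter> ball x \<delta>"] conjI)
      show "openin (top_of_set T) (T \<inter> ball x \<delta>)" by (simp add: openin_open_Int)
      show "negligible (T \<inter> ball x \<delta>)"
        by (rule negligible_subset[OF \<delta>(2)]) (auto simp: T_def dist_real_def abs_minus_commute)
    qed (use \<open>x \<in> T\<close> \<delta> in auto)
  qed
  then obtain Z where Z: "Z \<in> null_sets lborel" "T \<subseteq> Z"
    unfolding negligible_iff_null_sets null_sets_completion_iff2 by blast
  then have "Z \<union> exceptional \<in> null_sets lborel"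
    using countable_imp_null_set_lborel[OF countable_exceptional] by (intro null_sets.Un)
  then show ?thesis
    by (rule AE_I') (use Z in \<open>auto simp: T_def\<close>)
qed

end

section \<open>Geometry of the tangent line\<close>

lemma cross_eq_inner: "cross a b = (\<i> * a) \<bullet> b"
  by (simp add: cross_simps inner_complex_def algebra_simps)

lemma side_affine:
  "a + b = 1 \<Longrightarrow> side d u k (of_real a * x + of_real b * y) = a * side d u k x + b * side d u k y"
proof -
  assume "a + b = 1"
  then have b: "b = 1 - a" by simp
  show ?thesis unfolding b by (simp add: side_def cross_simps algebra_simps)
qed

lemma mem_affine_hull_2_iff:
  assumes "w \<noteq> z"
  shows "x \<in> affine hull {z, w} \<longleftrightarrow> cross (w - z) (x - z) = 0"
proof
  assume "x \<in> affine hull {z, w}"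
  then obtain a b where ab: "x = a *\<^sub>R z + b *\<^sub>R w" "a + b = 1" unfolding affine_hull_2 by blast
  then have a: "a = 1 - b" by simp
  show "cross (w - z) (x - z) = 0" unfolding ab(1) a by (simp add: cross_simps algebra_simps)
next
  assume "cross (w - z) (x - z) = 0"
  then obtain s where "x - z = of_real s * (w - z)" using cross_collinear assms by (metis right_minus_eq)
  then have "x = (1 - s) *\<^sub>R z + s *\<^sub>R w" by (simp add: scaleR_conv_of_real algebra_simps)
  then show "x \<in> affine hull {z, w}" unfolding affine_hull_2 by (smt (verit) mem_Collect_eq)
qed

context ccw_polygon
begin

abbreviation "P \<equiv> polygon d u"

lemma vertex_in_P: "k < d \<Longrightarrow> u k \<in> P"
  unfolding polygon_def by (intro hull_inc) auto

lemma P_sub_side: "\<lbrakk>x \<in> P; k < d\<rbrakk> \<Longrightarrow> 0 \<le> h k x"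
proof -
  assume x: "x \<in> P" and k: "k < d"
  have "convex {x. 0 \<le> h k x}"
    unfolding convex_def scaleR_conv_of_real by (auto simp: side_affine)
  then have "P \<subseteq> {x. 0 \<le> h k x}"
    unfolding polygon_def by (intro hull_minimal) (use h_nonneg k in auto)
  then show ?thesis using x by auto
qed

text \<open>The barycentric coordinates of \<open>z\<close> are quotients of oriented areas.\<close>

lemma triangle_in_P:
  assumes "a < d" "b < d" "c < d" and pos: "0 < cross (u b - u a) (u c - u a)"
    and "0 \<le> cross (u b - u a) (z - u a)" "0 \<le> cross (u c - u b) (z - u b)" "0 \<le> cross (u a - u c) (z - u c)"
  shows "z \<in> P"
proof -
  define D where "D = cross (u b - u a) (u c - u a)"
  define \<alpha> where "\<alpha> = cross (u c - u b) (z - u b) / D"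
  define \<beta> where "\<beta> = cross (u a - u c) (z - u c) / D"
  define \<gamma> where "\<gamma> = cross (u b - u a) (z - u a) / D"
  have nn: "0 \<le> \<alpha>" "0 \<le> \<beta>" "0 \<le> \<gamma>" using assms by (auto simp: \<alpha>_def \<beta>_def \<gamma>_def D_def)
  have D: "D \<noteq> 0" using pos by (simp add: D_def)
  have "\<alpha> * D + \<beta> * D + \<gamma> * D = D"
    using D by (simp add: \<alpha>_def \<beta>_def \<gamma>_def) (simp add: D_def cross_simps algebra_simps)
  then have sum: "\<alpha> + \<beta> + \<gamma> = 1" using D by (metis distrib_right mult_cancel_right1 mult.commute)
  have "of_real D * z = of_real (\<alpha> * D) * u a + of_real (\<beta> * D) * u b + of_real (\<gamma> * D) * u c"
    using D by (simp add: \<alpha>_def \<beta>_def \<gamma>_def complex_eq_iff) (simp add: D_def cross_simps algebra_simps)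
  then have "of_real D * z = of_real D * (of_real \<alpha> * u a + of_real \<beta> * u b + of_real \<gamma> * u c)"
    by (simp add: algebra_simps)
  then have "z = \<alpha> *\<^sub>R u a + \<beta> *\<^sub>R u b + \<gamma> *\<^sub>R u c"
    using D by (simp add: scaleR_conv_of_real)
  then have "z \<in> convex hull {u a, u b, u c}"
    unfolding convex_hull_3 using nn sum by blast
  then show ?thesis
    unfolding polygon_def using hull_mono[of "{u a, u b, u c}" "u ` {..<d}"] assms by blast
qed

text \<open>Fan triangulation from \<open>u 0\<close>.\<close>

lemma sides_imp_P:
  assumes "\<And>k. k < d \<Longrightarrow> 0 \<le> h k z"
  shows "z \<in> P"
proof -
  define f where "f m = cross (u m - u 0) (z - u 0)" for m
  have nx_eq: "nx m = Suc m" if "Suc m < d" for m using that by (simp add: nxt_def)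
  have "nx (d - 1) = 0" using d3 by (simp add: nxt_def)
  then have "f (d - 1) = - h (d - 1) z" by (simp add: f_def side_def cross_simps algebra_simps)
  then have fd: "f (d - 1) \<le> 0" using assms[of "d - 1"] d3 by simp
  have f1: "0 \<le> f 1" using assms[of 0] nx_eq[of 0] d3 by (simp add: f_def side_def)
  \<comment> \<open>Since \<open>f\<close> is nonnegative at 1 and nonpositive at
    \<open>d - 1\<close>, it changes sign from some \<open>m\<close> to \<open>Suc m\<close>; this
    picks the triangle of the fan whose wedge at \<open>u 0\<close> contains
    \<open>z\<close>.\<close>
  have "\<exists>m. 1 \<le> m \<and> m < d - 1 \<and> 0 \<le> f m \<and> f (Suc m) \<le> 0"
  proof (rule ccontr)
    assume no: "\<not> ?thesis"
    have "1 \<le> m \<longrightarrow> m \<le> d - 1 \<longrightarrow> 0 \<le> f m \<and> (m > 1 \<longrightarrow> 0 < f m)" for m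
    proof (induction m)
      case (Suc m)
      show ?case
      proof (intro impI)
        assume "Suc m \<le> d - 1"
        then have "m < d - 1" by simp
        then show "0 \<le> f (Suc m) \<and> (1 < Suc m \<longrightarrow> 0 < f (Suc m))"
          using no f1 Suc by (cases "m = 0") force+
      qed
    qed simp
    moreover have "1 \<le> d - 1" "d - 1 \<le> d - 1" "1 < d - 1" using d3 by auto
    ultimately have "0 < f (d - 1)" by blast
    then show False using fd by simp
  qed
  then obtain m where m: "1 \<le> m" "m < d - 1" "0 \<le> f m" "f (Suc m) \<le> 0" by blast
  then have nxm: "nx m = Suc m" by (intro nx_eq) simp
  show ?thesis
  proof (rule triangle_in_P[of 0 m "Suc m"])
    have "0 < h m (u 0)" using m nxm by (intro h_pos) auto
    then show "0 < cross (u m - u 0) (u (Suc m) - u 0)"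
      by (simp add: side_def nxm cross_simps algebra_simps)
    show "0 \<le> cross (u m - u 0) (z - u 0)" using m by (simp add: f_def)
    show "0 \<le> cross (u (Suc m) - u m) (z - u m)" using assms[of m] m by (simp add: side_def nxm)
    show "0 \<le> cross (u 0 - u (Suc m)) (z - u (Suc m))"
      using m(4) by (simp add: f_def cross_simps algebra_simps)
  qed (use m d3 in auto)
qed

lemma edge_nonzero: "k < d \<Longrightarrow> u (nx k) - u k \<noteq> 0"
  using vertex_inj[of "nx k" k] by auto

lemma interior_P_side: "\<lbrakk>x \<in> interior P; k < d\<rbrakk> \<Longrightarrow> 0 < h k x"
proof -
  assume x: "x \<in> interior P" and k: "k < d"
  define a where "a = \<i> * (u (nx k) - u k)"
  have "P \<subseteq> {x. a \<bullet> x \<ge> a \<bullet> u k}"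
    using P_sub_side[OF _ k] by (auto simp: side_def cross_eq_inner a_def inner_diff_right)
  then have "x \<in> interior {x. a \<bullet> x \<ge> a \<bullet> u k}" using x interior_mono by blast
  moreover have "a \<noteq> 0" using edge_nonzero[OF k] by (simp add: a_def)
  ultimately have "a \<bullet> x > a \<bullet> u k" by (simp add: interior_halfspace_ge)
  then show ?thesis by (simp add: side_def cross_eq_inner a_def inner_diff_right)
qed

text \<open>Some edge faces \<open>z\<close>, but not all do. Going round the polygon there is a
  change from a facing edge to one that does not face \<open>z\<close>, at the vertex between
  them.\<close>

lemma exists_tangent_vertex:
  assumes "z \<notin> P"
  shows "\<exists>k<d. h (pv k) z < 0 \<and> 0 \<le> h k z"
proof -
  obtain a where a: "a < d" "h a z < 0" using sides_imp_P[of z] assms by (meson not_le)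
  have bij: "bij_betw nx {..<d} {..<d}"
    by (rule bij_betw_byWitness[where f' = pv]) auto
  \<comment> \<open>The sum of the edge functions is twice the area of the polygon, independent of
    \<open>x\<close>; evaluated at \<open>u 0\<close> it is nonnegative.\<close>
  have tot: "(\<Sum>k<d. h k x) = (\<Sum>k<d. cross (u k) (u (nx k)))" for x
  proof -
    have "(\<Sum>k<d. h k x) = (\<Sum>k<d. cross (u k) (u (nx k)) + (cross (u (nx k)) x - cross (u k) x))"
      by (intro sum.cong refl) (simp add: side_def cross_simps algebra_simps)
    also have "\<dots> = (\<Sum>k<d. cross (u k) (u (nx k))) + ((\<Sum>k<d. cross (u (nx k)) x) - (\<Sum>k<d. cross (u k) x))"
      by (simp add: sum.distrib sum_subtractf)
    also have "(\<Sum>k<d. cross (u (nx k)) x) = (\<Sum>k<d. cross (u k) x)"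
      by (rule sum.reindex_bij_betw[OF bij])
    finally show ?thesis by simp
  qed
  have "\<exists>b<d. 0 \<le> h b z"
  proof (rule ccontr)
    assume "\<not> ?thesis"
    then have "(\<Sum>k<d. h k z) < (\<Sum>k<d. 0)" using d3 by (intro sum_strict_mono) (auto simp: lessThan_empty_iff)
    moreover have "0 \<le> (\<Sum>k<d. h k (u 0))" using d3 h_nonneg by (intro sum_nonneg) auto
    ultimately show False unfolding tot by simp
  qed
  then obtain b where b: "b < d" "0 \<le> h b z" by blast
  show ?thesis
  proof (rule ccontr)
    assume "\<not> ?thesis"
    then have no: "h k z < 0" if "k < d" "h (pv k) z < 0" for k using that by (meson not_le)
    have "h ((a + n) mod d) z < 0" for n
    proof (induction n)
      case (Suc n)
      have "(a + Suc n) mod d = nx ((a + n) mod d)" by (simp add: nxt_def mod_Suc_eq)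
      then show ?case using no[of "nx ((a + n) mod d)"] Suc d3 by simp
    qed (use a in simp)
    from this[of "b + d - a"] show False using a b by simp
  qed
qed

context
  fixes k z
  assumes k: "k < d" and z: "h (pv k) z < 0" "0 \<le> h k z" and int: "interior P \<noteq> {}"
begin

lemma z_neq_vertex: "u k \<noteq> z"
  using z k by auto

lemma tangent_nonneg:
  "x \<in> P \<Longrightarrow> 0 \<le> cross (u k - z) (x - z)"
  "x \<in> interior P \<Longrightarrow> 0 < cross (u k - z) (x - z)"
proof -
  let ?D = "h (pv k) (u (nx k))"
  have eq: "?D * cross (u k - z) (x - z) = h k z * h (pv k) x - h (pv k) z * h k x" for x
    using pluecker[OF k, of z x] by (simp add: cross_simps algebra_simps)
  note D = corner_pos[OF k]
  show "0 \<le> cross (u k - z) (x - z)" if "x \<in> P"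
  proof -
    have "0 \<le> h k z * h (pv k) x" "h (pv k) z * h k x \<le> 0"
      using z P_sub_side[OF that] k by (auto simp: mult_nonpos_nonneg)
    then have "0 \<le> ?D * cross (u k - z) (x - z)" unfolding eq by linarith
    then show ?thesis using D by (simp add: zero_le_mult_iff)
  qed
  show "0 < cross (u k - z) (x - z)" if "x \<in> interior P"
  proof -
    have "0 \<le> h k z * h (pv k) x" "h (pv k) z * h k x < 0"
      using z interior_P_side[OF that] k by (auto simp: mult_neg_pos less_imp_le)
    then have "0 < ?D * cross (u k - z) (x - z)" unfolding eq by linarith
    then show ?thesis using D by (simp add: zero_less_mult_iff)
  qed
qed

lemma on_tangent:
  assumes "w \<in> affine hull {z, u k}" "w \<in> P"
  obtains s where "1 \<le> s" "w = z + of_real s * (u k - z)" "h (pv k) w = (1 - s) * h (pv k) z"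
    "h k w = (1 - s) * h k z"
proof -
  have "cross (u k - z) (w - z) = 0" using assms(1) mem_affine_hull_2_iff[OF z_neq_vertex] by blast
  then obtain s where "w - z = of_real s * (u k - z)"
    using cross_collinear z_neq_vertex by (metis right_minus_eq)
  then have w: "w = z + of_real s * (u k - z)" by (simp add: algebra_simps)
  have w': "w = of_real (1 - s) * z + of_real s * u k" by (simp add: w algebra_simps)
  have hw: "h (pv k) w = (1 - s) * h (pv k) z" "h k w = (1 - s) * h k z"
    unfolding w' using side_affine[of "1 - s" s] k by auto
  then have "0 \<le> (1 - s) * h (pv k) z" using P_sub_side[OF assms(2) pv_lt, of k] by simp
  then have "1 \<le> s" using z by (simp add: zero_le_mult_iff)
  then show ?thesis using that w hw by blast
qed

text \<open>The hypothesis on \<open>z\<close> is half-open, so points on the singular ray of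
  \<open>k\<close> are included.\<close>

lemma tangent_line_eq: "tangent_line P z = affine hull {z, u k}"
  unfolding tangent_line_def
proof (rule the_equality)
  let ?L = "affine hull {z, u k}"
  have dimL: "aff_dim ?L = 1" using z_neq_vertex by (simp add: aff_dim_affine_hull aff_dim_2)
  have "?L \<inter> interior P = {}"
    using tangent_nonneg(2) mem_affine_hull_2_iff[OF z_neq_vertex] by fastforce
  moreover have "u k \<in> ?L \<inter> P" using vertex_in_P[OF k] by (auto intro: hull_inc)
  ultimately have "supporting_line P ?L"
    unfolding supporting_line_def using dimL affine_affine_hull by blast
  moreover have "left_of z w x" if w: "w \<in> ?L \<inter> P" and x: "x \<in> interior P" for w x
  proof -
    obtain s where s: "1 \<le> s" "w = z + of_real s * (u k - z)" using w on_tangent by blast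
    have "Im (cnj (w - z) * (x - z)) = s * cross (u k - z) (x - z)"
      by (simp add: s(2) cross_def algebra_simps)
    then show ?thesis using s(1) tangent_nonneg(2)[OF x] by (simp add: left_of_def)
  qed
  ultimately show "supporting_line P ?L \<and> z \<in> ?L \<and> (\<forall>w\<in>?L \<inter> P. \<forall>x\<in>interior P. left_of z w x)"
    by (auto intro: hull_inc)
  fix L assume L: "supporting_line P L \<and> z \<in> L \<and> (\<forall>w\<in>L \<inter> P. \<forall>x\<in>interior P. left_of z w x)"
  then obtain w where w: "w \<in> L" "w \<in> P" unfolding supporting_line_def by blast
  have P: "convex P" "compact P" unfolding polygon_def by (auto intro: compact_convex_hull finite_imp_compact)
  have "closed {x. (\<i> * (w - z)) \<bullet> x \<ge> (\<i> * (w - z)) \<bullet> z}" by (rule closed_halfspace_ge)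
  moreover have "interior P \<subseteq> {x. (\<i> * (w - z)) \<bullet> x \<ge> (\<i> * (w - z)) \<bullet> z}"
  proof
    fix x assume "x \<in> interior P"
    then have "0 < cross (w - z) (x - z)" using L w by (auto simp: left_of_def cross_def)
    then show "x \<in> {x. (\<i> * (w - z)) \<bullet> x \<ge> (\<i> * (w - z)) \<bullet> z}"
      unfolding cross_eq_inner by (simp add: inner_diff_right)
  qed
  ultimately have "closure (interior P) \<subseteq> {x. (\<i> * (w - z)) \<bullet> x \<ge> (\<i> * (w - z)) \<bullet> z}"
    by (rule closure_minimal[rotated])
  moreover have "closure (interior P) = P"
    using convex_closure_interior[OF P(1) int] closure_closed[OF compact_imp_closed[OF P(2)]] by simp
  \<comment> \<open>The strict condition on the interior passes to its closure \<open>P\<close>. Now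
    \<open>u k\<close> and \<open>w\<close> each lie weakly to the left of the line from
    \<open>z\<close> through the other, so these lines coincide.\<close>
  ultimately have "0 \<le> cross (w - z) (u k - z)"
    using vertex_in_P[OF k] unfolding cross_eq_inner by (auto simp: inner_diff_right)
  moreover have "0 \<le> cross (u k - z) (w - z)" using tangent_nonneg w by blast
  ultimately have "cross (u k - z) (w - z) = 0" by (simp add: cross_simps algebra_simps)
  then have wL: "w \<in> ?L" using mem_affine_hull_2_iff[OF z_neq_vertex] by blast
  have "w \<noteq> z" using P_sub_side[OF w(2), of "pv k"] z by auto
  then have dim: "aff_dim (affine hull {z, w}) = 1" by (simp add: aff_dim_affine_hull aff_dim_2)
  have sub: "affine hull {z, w} \<subseteq> L"
    by (rule hull_minimal) (use L w in \<open>auto simp: supporting_line_def\<close>)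
  have sub': "affine hull {z, w} \<subseteq> ?L"
    by (rule hull_minimal) (use wL in \<open>auto intro: hull_inc affine_affine_hull\<close>)
  have ne: "affine hull {z, w} \<noteq> {}" by (simp add: affine_hull_eq_empty)
  have "affine hull {z, w} = L"
    by (rule affine_dim_equal[OF affine_affine_hull _ ne sub]) (use L dim in \<open>auto simp: supporting_line_def\<close>)
  moreover have "affine hull {z, w} = ?L"
    by (rule affine_dim_equal[OF affine_affine_hull affine_affine_hull ne sub']) (simp only: dim dimL)
  ultimately show "L = ?L" by simp
qed

lemma tangent_meets_vertex:
  assumes "0 < h k z"
  shows "tangent_line P z \<inter> P = {u k}" and "z \<notin> singular_set P"
proof -
  show eq: "tangent_line P z \<inter> P = {u k}"
    unfolding tangent_line_eq
  proof (intro equalityI subsetI)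
    fix w assume w: "w \<in> affine hull {z, u k} \<inter> P"
    then obtain s where s: "1 \<le> s" "w = z + of_real s * (u k - z)" "h k w = (1 - s) * h k z"
      using on_tangent by blast
    have "0 \<le> (1 - s) * h k z" using s(3) P_sub_side[of w k] w k by simp
    then have "s \<le> 1" using assms by (simp add: zero_le_mult_iff)
    then show "w \<in> {u k}" using s by simp
  qed (use vertex_in_P[OF k] in \<open>auto intro: hull_inc\<close>)
  show "z \<notin> singular_set P"
  proof
    assume "z \<in> singular_set P"
    then obtain e where e: "e edge_of P" "e \<subseteq> tangent_line P z" by (auto simp: singular_set_def)
    then have "e \<subseteq> P" by (simp add: edge_of_imp_subset)
    then have "e \<subseteq> {u k}" using e eq by blast
    then have "aff_dim e \<le> aff_dim {u k}" by (rule aff_dim_subset)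
    then show False using e by (simp add: edge_of_def)
  qed
qed

lemma tangent_along_edge:
  assumes "h k z = 0" "closed_segment (u k) (u (nx k)) edge_of P"
  shows "z \<in> singular_set P"
proof -
  have "h (pv k) (u (nx k)) * cross (u k - z) (u (nx k) - z) = 0"
    using pluecker[OF k, of z "u (nx k)"] assms(1) by (simp add: cross_simps algebra_simps)
  then have "cross (u k - z) (u (nx k) - z) = 0" using corner_pos[OF k] by simp
  then have "u (nx k) \<in> affine hull {z, u k}" using mem_affine_hull_2_iff[OF z_neq_vertex] by blast
  moreover have "u k \<in> affine hull {z, u k}" by (intro hull_inc) auto
  ultimately have "closed_segment (u k) (u (nx k)) \<subseteq> tangent_line P z"
    unfolding tangent_line_eq by (intro closed_segment_subset affine_imp_convex affine_affine_hull)
  moreover have "z \<notin> P" using P_sub_side[of z "pv k"] z by auto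
  ultimately show ?thesis using assms(2) by (auto simp: singular_set_def)
qed

end

lemma open_cone_iff:
  assumes "interior P \<noteq> {}" "\<And>k. k < d \<Longrightarrow> closed_segment (u k) (u (nx k)) edge_of P"
  shows "z \<notin> P \<and> z \<notin> singular_set P \<longleftrightarrow> (\<exists>k<d. z \<in> OC k)"
proof
  assume z: "z \<notin> P \<and> z \<notin> singular_set P"
  then obtain k where k: "k < d" "h (pv k) z < 0" "0 \<le> h k z" using exists_tangent_vertex by blast
  then have "h k z \<noteq> 0" using tangent_along_edge[OF k assms(1) _ assms(2)[OF k(1)]] z by blast
  then show "\<exists>k<d. z \<in> OC k" using k by (intro exI[of _ k]) (auto simp: open_cone_def)
next
  assume "\<exists>k<d. z \<in> OC k"
  then obtain k where k: "k < d" "h (pv k) z < 0" "0 < h k z" by (auto simp: open_cone_def)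
  then show "z \<notin> P \<and> z \<notin> singular_set P"
    using tangent_meets_vertex(2)[of k z] assms(1) P_sub_side[of z "pv k"] by auto
qed

lemma step_notin_P:
  assumes "0 < l" "k < d" "z \<in> OC k"
  shows "step l (u k) z \<notin> P"
proof
  assume "step l (u k) z \<in> P"
  then have "0 \<le> h k (step l (u k) z)" using P_sub_side assms by blast
  moreover have "0 < l * h k z" using assms by (simp add: open_cone_def)
  ultimately show False by (simp add: side_step)
qed

text \<open>The billiard map depends on the labelling only through the names of the vertices, so a
  permutation transfers the counterclockwise analysis to a clockwise \<open>v\<close>.\<close>

lemma asymptotically_periodic_relabelled:
  assumes l: "0 < l" "l < 1" and sep: "separated d u l"
    and int: "interior P \<noteq> {}" and edges: "\<And>k. k < d \<Longrightarrow> closed_segment (u k) (u (nx k)) edge_of P"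
    and \<sigma>: "bij_betw \<sigma> {..<d} {..<d}" and v: "\<And>k. k < d \<Longrightarrow> v k = u (\<sigma> k)"
  shows "asymptotically_periodic d v l"
proof -
  define f where "f = outer_billiard d v l"
  have "v ` {..<d} = u ` \<sigma> ` {..<d}" using v by (force simp: image_iff)
  then have Pv: "polygon d v = P" using \<sigma> by (simp add: polygon_def bij_betw_def)
  have f_cone: "f z = step l (u m) z" if m: "m < d" "z \<in> OC m" for m z
  proof -
    have z: "h (pv m) z < 0" "0 < h m z" using m by (auto simp: open_cone_def)
    note t = tangent_meets_vertex[OF m(1) z(1) less_imp_le[OF z(2)] int z(2)]
    have zP: "z \<notin> P" using P_sub_side[of z "pv m"] z by auto
    obtain j where j: "j < d" "\<sigma> j = m" using \<sigma> m(1) by (metis bij_betw_iff_bijections lessThan_iff)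
    have "(THE k. k < d \<and> z \<in> vertex_cone d v k) = j"
    proof (rule the_equality)
      show "j < d \<and> z \<in> vertex_cone d v j"
        using j v[of j] t zP by (simp add: vertex_cone_def Pv)
      fix k assume k: "k < d \<and> z \<in> vertex_cone d v k"
      then have "v k = u m" using t by (simp add: vertex_cone_def Pv)
      then have "u (\<sigma> k) = u (\<sigma> j)" using k v j by simp
      then have "\<sigma> k = \<sigma> j" using vertex_inj \<sigma> k j by (metis bij_betwE lessThan_iff)
      then show "k = j" using \<sigma> k j by (metis bij_betw_def inj_onD lessThan_iff)
    qed
    then show ?thesis using j v[of j] by (simp add: f_def outer_billiard_def step_def)
  qed
  interpret contracting_billiard d u l f
    by unfold_locales (use l f_cone in auto)
  \<comment> \<open>\<open>non_singular\<close> requires only the starting point to avoid the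
    polygon; \<open>step_notin_P\<close> keeps the iterates outside, so that
    \<open>open_cone_iff\<close> applies at each time.\<close>
  have ns: "non_singular d v l z \<longleftrightarrow> regular z" for z
  proof
    assume ns: "non_singular d v l z"
    have "\<exists>k<d. (f ^^ n) z \<in> OC k" for n
    proof -
      have "(f ^^ n) z \<notin> P"
      proof (induction n)
        case 0
        then show ?case using ns by (simp add: non_singular_def Pv)
      next
        case (Suc n)
        then obtain k where "k < d" "(f ^^ n) z \<in> OC k"
          using open_cone_iff[OF int edges, of "(f ^^ n) z"] ns by (auto simp: non_singular_def Pv f_def)
        then show ?case using step_notin_P[OF l(1)] f_cone by simp
      qed
      then show ?thesis
        using open_cone_iff[OF int edges, of "(f ^^ n) z"] ns by (auto simp: non_singular_def Pv f_def)
    qed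
    then show "regular z" by (simp add: regular_def)
  next
    assume "regular z"
    then have "(f ^^ n) z \<notin> P \<and> (f ^^ n) z \<notin> singular_set P" for n
      using open_cone_iff[OF int edges] unfolding regular_def by blast
    from this this[of 0] show "non_singular d v l z"
      by (simp add: non_singular_def Pv f_def)
  qed
  have po: "periodic_orbits d v l = orbit f ` {z. regular z \<and> (\<exists>p>0. (f ^^ p) z = z)}"
    by (auto simp: periodic_orbits_def ns f_def)
  show ?thesis
    unfolding asymptotically_periodic_def
  proof (intro conjI allI impI)
    show "finite (periodic_orbits d v l)"
      unfolding po using separated_imp_periodic(1)[OF sep] by simp
    fix z assume "non_singular d v l z"
    then obtain q where "regular q" "\<exists>p>0. (f ^^ p) q = q" "omega_limit f z = orbit f q"
      using separated_imp_periodic(2)[OF sep] ns by blast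
    then show "omega_limit (outer_billiard d v l) z \<in> periodic_orbits d v l"
      unfolding po by (auto simp: f_def)
  qed
qed

end

section \<open>Orientation of a labelling\<close>

definition reversal :: "nat \<Rightarrow> nat \<Rightarrow> nat" where
  "reversal d k = d - Suc k"

context cyclic_index
begin

lemma reversal_lt [simp]: "reversal d k < d"
  using d3 by (simp add: reversal_def)

lemma reversal_reversal [simp]: "k < d \<Longrightarrow> reversal d (reversal d k) = k"
  by (simp add: reversal_def)

lemma bij_reversal: "bij_betw (reversal d) {..<d} {..<d}"
  by (rule bij_betw_byWitness[where f' = "reversal d"]) auto

lemma nx_reversal_nx: "k < d \<Longrightarrow> nx (reversal d (nx k)) = reversal d k"
  using d3 by (cases "Suc k = d") (auto simp: nxt_def reversal_def Suc_diff_Suc)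

text \<open>The edge is an exposed face: a linear functional is constant on it and strictly smaller
  at the other vertices. In the plane such a functional is a nonzero multiple of
  \<open>side\<close>, up to a constant.\<close>

lemma sides_same_sign:
  assumes v: "v \<in> convex_gons d" and k: "k < d"
  shows "(\<forall>m<d. m \<noteq> k \<longrightarrow> m \<noteq> nx k \<longrightarrow> 0 < side d v k (v m)) \<or>
         (\<forall>m<d. m \<noteq> k \<longrightarrow> m \<noteq> nx k \<longrightarrow> side d v k (v m) < 0)"
proof -
  let ?P = "polygon d v"
  define e where "e = closed_segment (v k) (v (nx k))"
  have bij: "bij_betw v {..<d} {x. x extreme_point_of ?P}" and "polytope ?P"
    and edge: "e edge_of ?P"
    using v k by (auto simp: convex_gons_def convex_gon_def e_def nxt_def)
  then have "e exposed_face_of ?P"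
    by (simp add: edge_of_def exposed_face_of_polyhedron polytope_imp_polyhedron)
  then obtain a b where ab: "?P \<subseteq> {x. a \<bullet> x \<le> b}" "e = ?P \<inter> {x. a \<bullet> x = b}"
    unfolding exposed_face_of_def by blast
  have ext: "v m extreme_point_of ?P" if "m < d" for m
    using bij that by (auto simp: bij_betw_def)
  have inj: "v m \<noteq> v n" if "m < d" "n < d" "m \<noteq> n" for m n
    using bij that by (auto simp: bij_betw_def inj_on_def)
  have inP: "v m \<in> ?P" if "m < d" for m using ext[OF that] by (simp add: extreme_point_of_def)
  have ends: "a \<bullet> v k = b" "a \<bullet> v (nx k) = b"
    using ab(2) by (auto simp: e_def)
  have strict: "a \<bullet> v m < b" if m: "m < d" "m \<noteq> k" "m \<noteq> nx k" for m
  proof -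
    have "v m \<notin> e"
    proof
      assume "v m \<in> e"
      then have "v m \<in> open_segment (v k) (v (nx k))"
        using inj[of m k] inj[of m "nx k"] m k by (simp add: e_def open_segment_def)
      then show False using ext[OF m(1)] inP k by (auto simp: extreme_point_of_def)
    qed
    then show ?thesis using ab inP[OF m(1)] by (auto simp: order.strict_iff_order)
  qed
  define w where "w = v (nx k) - v k"
  define c where "c = a \<bullet> (\<i> * w)"
  have aw: "a \<bullet> w = 0" using ends by (simp add: w_def inner_diff_right)
  have neg: "c * side d v k (v m) < 0" if m: "m < d" "m \<noteq> k" "m \<noteq> nx k" for m
  proof -
    let ?x = "v m - v k"
    \<comment> \<open>Expansion of \<open>?x\<close> in the orthogonal basis formed by
      \<open>w\<close> and \<open>\<i> * w\<close>.\<close>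
    have "(w \<bullet> w) * (a \<bullet> ?x) = (a \<bullet> w) * (w \<bullet> ?x) + c * cross w ?x"
      by (simp add: c_def inner_complex_def cross_simps algebra_simps)
    then have "c * cross w ?x = (w \<bullet> w) * (a \<bullet> ?x)" using aw by simp
    moreover have "a \<bullet> ?x < 0" using strict[OF m] ends by (simp add: inner_diff_right)
    moreover have "0 < w \<bullet> w" using inj[of "nx k" k] k by (simp add: w_def)
    ultimately show ?thesis by (simp add: side_def w_def mult_pos_neg)
  qed
  show ?thesis using neg by (cases "c > 0") (auto simp: mult_less_0_iff)
qed

text \<open>Consecutive edges share the triangle of \<open>k\<close>, \<open>nx k\<close>,
  \<open>nx (nx k)\<close>, whose orientation both see, so the sign of edge 0 propagates round the
  polygon.\<close>

lemma convex_gons_orientation: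
  assumes v: "v \<in> convex_gons d"
  shows "ccw d v \<or> ccw d (v \<circ> reversal d)"
proof -
  define pos where "pos k \<longleftrightarrow> (\<forall>m<d. m \<noteq> k \<longrightarrow> m \<noteq> nx k \<longrightarrow> 0 < side d v k (v m))" for k
  define neg where "neg k \<longleftrightarrow> (\<forall>m<d. m \<noteq> k \<longrightarrow> m \<noteq> nx k \<longrightarrow> side d v k (v m) < 0)" for k
  have pn: "pos k \<or> neg k" if "k < d" for k
    using sides_same_sign[OF v that] by (simp add: pos_def neg_def)
  have step: "(pos k \<longrightarrow> pos (nx k)) \<and> (neg k \<longrightarrow> neg (nx k))" if k: "k < d" for k
  proof -
    have eq: "side d v k (v (nx (nx k))) = side d v (nx k) (v k)"
      by (simp add: side_def cross_simps algebra_simps)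
    have m: "nx (nx k) < d" "nx (nx k) \<noteq> k" "nx (nx k) \<noteq> nx k" "k \<noteq> nx k" "k \<noteq> nx (nx k)"
      using k by auto
    have "pos k \<Longrightarrow> \<not> neg (nx k)" "neg k \<Longrightarrow> \<not> pos (nx k)"
      unfolding pos_def neg_def using m k eq by (metis less_asym)+
    then show ?thesis using pn[of "nx k"] by auto
  qed
  have all: "(pos 0 \<longrightarrow> pos (n mod d)) \<and> (neg 0 \<longrightarrow> neg (n mod d))" for n
  proof (induction n)
    case (Suc n)
    have "Suc n mod d = nx (n mod d)" by (simp add: nxt_def mod_Suc_eq)
    then show ?case using Suc step[of "n mod d"] d3 by simp
  qed simp
  have "pos 0 \<or> neg 0" using pn d3 by simp
  then show ?thesis
  proof
    assume "pos 0"
    then have "pos k" if "k < d" for k using all[of k] that by simp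
    then show ?thesis by (auto simp: ccw_def pos_def)
  next
    assume "neg 0"
    then have negk: "neg k" if "k < d" for k using all[of k] that by simp
    have "0 < side d (v \<circ> reversal d) k ((v \<circ> reversal d) m)" if "k < d" "m < d" "m \<noteq> k" "m \<noteq> nx k" for k m
    proof -
      let ?k = "reversal d (nx k)"
      have nk: "nx ?k = reversal d k" using that nx_reversal_nx by simp
      have "reversal d m \<noteq> ?k" "reversal d m \<noteq> nx ?k"
        unfolding nk using that reversal_reversal by (metis nx_lt)+
      then have "side d v ?k (v (reversal d m)) < 0"
        using negk[of ?k] by (simp add: neg_def)
      then show ?thesis unfolding side_def nk by (simp add: cross_simps algebra_simps)
    qed
    then show ?thesis by (auto simp: ccw_def)
  qed
qed

lemma asymptotically_periodic_if_separated:
  assumes v: "v \<in> convex_gons d" and l: "0 < l" "l < 1"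
    and "ccw d v \<Longrightarrow> separated d v l"
    and "ccw d (v \<circ> reversal d) \<Longrightarrow> separated d (v \<circ> reversal d) l"
  shows "asymptotically_periodic d v l"
proof -
  have int: "interior (polygon d v) \<noteq> {}" and edge: "\<And>k. k < d \<Longrightarrow> closed_segment (v k) (v (nx k)) edge_of polygon d v"
    using v by (auto simp: convex_gons_def convex_gon_def nxt_def)
  show ?thesis
    using convex_gons_orientation[OF v]
  proof
    assume c: "ccw d v"
    interpret ccw_polygon d v by unfold_locales (rule c)
    show ?thesis
      by (rule asymptotically_periodic_relabelled[OF l assms(4)[OF c] int edge, of id]) auto
  next
    assume c: "ccw d (v \<circ> reversal d)"
    interpret ccw_polygon d "v \<circ> reversal d" by unfold_locales (rule c)
    have "(v \<circ> reversal d) ` {..<d} = v ` {..<d}"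
      using bij_reversal by (metis bij_betw_imp_surj_on image_comp)
    then have eq: "polygon d (v \<circ> reversal d) = polygon d v" by (simp add: polygon_def)
    show ?thesis
    proof (rule asymptotically_periodic_relabelled[OF l assms(5)[OF c] _ _ bij_reversal])
      fix k assume "k < d"
      then have "closed_segment (v (reversal d (nx k))) (v (reversal d k)) edge_of polygon d v"
        using edge[of "reversal d (nx k)"] nx_reversal_nx[of k] by simp
      then show "closed_segment ((v \<circ> reversal d) k) ((v \<circ> reversal d) (nx k)) edge_of polygon d (v \<circ> reversal d)"
        by (simp add: eq closed_segment_commute)
    qed (use int in \<open>auto simp: eq\<close>)
  qed
qed

end

section \<open>Measurability and conclusion\<close>

lemma open_open_itinerary: "open {z. open_itinerary d u l w z}"
proof (induction w)
  case (Cons k w)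
  have "continuous_on UNIV (step l (u k))"
    unfolding step_def by (intro continuous_intros)
  then have "open (step l (u k) -` {z. open_itinerary d u l w z})"
    using Cons by (rule open_vimage[rotated])
  then have "open {z. open_itinerary d u l w (step l (u k) z)}"
    by (simp add: vimage_def)
  then show ?case
    unfolding open_itinerary.simps open_cone_def mem_Collect_eq
    by (intro open_Collect_conj open_Collect_less continuous_intros)
qed simp

text \<open>An open set meets a ball iff it does so in a point of a dense sequence. The sequence is
  chosen before polygon and parameter, so the quantifier over points becomes a countable
  one.\<close>

lemma countable_test_points:
  "\<exists>g :: nat \<Rightarrow> complex. \<forall>d u l w r. (\<exists>z\<in>ball 0 r. open_itinerary d u l w z) \<longleftrightarrow>
    (\<exists>i. cmod (g i) < r \<and> open_itinerary d u l w (g i))"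
proof -
  obtain D :: "complex set" where D: "countable D" "\<And>X. open X \<Longrightarrow> X \<noteq> {} \<Longrightarrow> \<exists>d\<in>D. d \<in> X"
    by (rule countable_dense_setE) blast
  have "D \<noteq> {}" using D(2)[of UNIV] by auto
  show ?thesis
  proof (intro exI[of _ "from_nat_into D"] allI, rule iffI)
    fix d u l w and r :: real
    assume "\<exists>z\<in>ball 0 r. open_itinerary d u l w z"
    then have "ball 0 r \<inter> {z. open_itinerary d u l w z} \<noteq> {}" by auto
    moreover have "open (ball 0 r \<inter> {z. open_itinerary d u l w z})"
      using open_open_itinerary by (intro open_Int) auto
    ultimately obtain z where z: "z \<in> D" "z \<in> ball 0 r" "open_itinerary d u l w z"
      using D(2)[of "ball 0 r \<inter> {z. open_itinerary d u l w z}"] by auto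
    moreover obtain i where "from_nat_into D i = z"
      using from_nat_into_surj[OF D(1) z(1)] by blast
    ultimately show "\<exists>i. cmod (from_nat_into D i) < r \<and> open_itinerary d u l w (from_nat_into D i)"
      by (intro exI[of _ i]) simp
  qed auto
qed

context
  fixes N :: "'a measure" and U :: "'a \<Rightarrow> nat \<Rightarrow> complex" and L :: "'a \<Rightarrow> real" and d :: nat
  assumes U [measurable]: "\<And>k. k < d \<Longrightarrow> (\<lambda>x. U x k) \<in> borel_measurable N"
    and L [measurable]: "L \<in> borel_measurable N" and d: "0 < d"
begin

lemma borel_measurable_side:
  assumes "k < d" and [measurable]: "Z \<in> borel_measurable N"
  shows "(\<lambda>x. side d (U x) k (Z x)) \<in> borel_measurable N"
proof -
  have [measurable]: "(\<lambda>x. U x k) \<in> borel_measurable N" "(\<lambda>x. U x (nxt d k)) \<in> borel_measurable N"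
    using assms d by (auto intro!: U simp: nxt_def)
  show ?thesis unfolding side_def cross_simps by measurable
qed

lemma pred_open_itinerary:
  assumes "set w \<subseteq> {..<d}" "Z \<in> borel_measurable N"
  shows "Measurable.pred N (\<lambda>x. open_itinerary d (U x) (L x) w (Z x))"
  using assms
proof (induction w arbitrary: Z)
  case (Cons k w)
  have "prv d k < d" using d by (simp add: prv_def)
  have [measurable]: "Z \<in> borel_measurable N" "(\<lambda>x. U x k) \<in> borel_measurable N"
    "(\<lambda>x. side d (U x) k (Z x)) \<in> borel_measurable N"
    "(\<lambda>x. side d (U x) (prv d k) (Z x)) \<in> borel_measurable N"
    using Cons.prems \<open>prv d k < d\<close> by (auto intro!: borel_measurable_side U)
  have "(\<lambda>x. step (L x) (U x k) (Z x)) \<in> borel_measurable N"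
    unfolding step_def by measurable
  then have [measurable]: "Measurable.pred N (\<lambda>x. open_itinerary d (U x) (L x) w (step (L x) (U x k) (Z x)))"
    using Cons by auto
  show ?case unfolding open_itinerary.simps open_cone_def mem_Collect_eq by measurable
qed simp

lemma pred_ccw: "Measurable.pred N (\<lambda>x. ccw d (U x))"
proof -
  have eq: "ccw d u \<longleftrightarrow> (\<forall>k\<in>{..<d}. \<forall>m\<in>{..<d}. m \<noteq> k \<longrightarrow> m \<noteq> nxt d k \<longrightarrow> 0 < side d u k (u m))" for u
    by (auto simp: ccw_def)
  show ?thesis
    unfolding eq
  proof (intro pred_intros_finite finite_lessThan)
    fix k m assume "k \<in> {..<d}" "m \<in> {..<d}"
    then have [measurable]: "(\<lambda>x. side d (U x) k (U x m)) \<in> borel_measurable N"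
      by (intro borel_measurable_side U) auto
    show "Measurable.pred N (\<lambda>x. m \<noteq> k \<longrightarrow> m \<noteq> nxt d k \<longrightarrow> 0 < side d (U x) k (U x m))"
      by measurable
  qed
qed

lemma borel_measurable_word_sum:
  assumes "a < d" "set w \<subseteq> {..<d}"
  shows "(\<lambda>x. word_sum d (U x) a w (L x)) \<in> borel_measurable N"
proof -
  have "(\<lambda>x. word_coeff d (U x) a w j) \<in> borel_measurable N" if "j < length w" for j
  proof -
    have "rev w ! j < d" using that assms by (metis length_rev lessThan_iff nth_mem set_rev subsetD)
    then have [measurable]: "(\<lambda>x. side d (U x) a (U x (rev w ! j))) \<in> borel_measurable N"
      using assms by (intro borel_measurable_side U)
    show ?thesis using that unfolding word_coeff_def by simp
  qed
  then show ?thesis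
    unfolding word_sum_def by (intro borel_measurable_sum borel_measurable_times borel_measurable_power L) auto
qed

text \<open>After replacing points by the test sequence, all quantifiers are countable. The vertices
  are an arbitrary measurable function, so that the reversed labelling is covered too.\<close>

lemma pred_separated: "Measurable.pred N (\<lambda>x. separated d (U x) (L x))"
proof -
  obtain g :: "nat \<Rightarrow> complex" where "\<forall>d u l w r. (\<exists>z\<in>ball 0 r. open_itinerary d u l w z) \<longleftrightarrow>
    (\<exists>i. cmod (g i) < r \<and> open_itinerary d u l w (g i))"
    using countable_test_points by (elim exE)
  note g = this[rule_format]
  have [measurable]: "(\<lambda>x. vertex_norm d (U x)) \<in> borel_measurable N"
    unfolding vertex_norm_def by (intro borel_measurable_sum borel_measurable_norm) (auto intro: U)
  have [measurable]: "(\<lambda>x. trap_radius d (U x) (L x)) \<in> borel_measurable N"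
    unfolding trap_radius_def by measurable
  have [measurable]: "(\<lambda>x. side_bound d (U x) (trap_radius d (U x) (L x))) \<in> borel_measurable N"
    unfolding side_bound_def by measurable
  have eq: "separated d u l \<longleftrightarrow> (\<exists>n. \<forall>w\<in>{w. set w \<subseteq> {..<d} \<and> length w = n}. \<forall>a\<in>{..<d}.
     (\<exists>i. cmod (g i) < trap_radius d u l \<and> open_itinerary d u l w (g i)) \<longrightarrow>
     l ^ n * side_bound d u (trap_radius d u l) < \<bar>(1 + l) * word_sum d u a w l\<bar>)" for u l
    unfolding separated_def g by (auto simp: lessThan_def)
  show ?thesis
    unfolding eq
  proof (intro pred_intros_countable pred_intros_finite finite_lists_length_eq finite_lessThan)
    fix n w a assume w: "w \<in> {w. set w \<subseteq> {..<d} \<and> length w = n}" and a: "a \<in> {..<d}"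
    have [measurable]: "(\<lambda>x. word_sum d (U x) a w (L x)) \<in> borel_measurable N"
      using w a by (intro borel_measurable_word_sum) auto
    have [measurable]: "Measurable.pred N (\<lambda>x. open_itinerary d (U x) (L x) w (g i))" for i
      using w by (intro pred_open_itinerary) auto
    show "Measurable.pred N (\<lambda>x. (\<exists>i. cmod (g i) < trap_radius d (U x) (L x) \<and> open_itinerary d (U x) (L x) w (g i)) \<longrightarrow>
     L x ^ n * side_bound d (U x) (trap_radius d (U x) (L x)) < \<bar>(1 + L x) * word_sum d (U x) a w (L x)\<bar>)"
      by measurable
  qed
qed

end

theorem theorem1p1:
  fixes d :: nat
  assumes "d \<ge> 3"
  shows "AE (v, l) in tuple_measure d \<Otimes>\<^sub>M (lborel :: real measure).
           v \<in> convex_gons d \<and> l \<in> {0<..<1} \<longrightarrow> asymptotically_periodic d v l"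
proof -
  let ?N = "tuple_measure d \<Otimes>\<^sub>M (lborel :: real measure)"
  interpret cyclic_index d by unfold_locales (rule assms)
  \<comment> \<open>Fubini requires a measurable event; \<open>Q\<close> is one and implies the
    claim for either orientation.\<close>
  define Q where "Q v l \<longleftrightarrow> l \<in> {0<..<1} \<longrightarrow> (ccw d v \<longrightarrow> separated d v l) \<and>
      (ccw d (v \<circ> reversal d) \<longrightarrow> separated d (v \<circ> reversal d) l)" for v l
  interpret product_sigma_finite "\<lambda>_::nat. lborel :: complex measure" by unfold_locales
  interpret fp: finite_product_sigma_finite "\<lambda>_::nat. lborel :: complex measure" "{..<d}"
    by unfold_locales simp
  interpret tm: sigma_finite_measure "tuple_measure d"
    unfolding tuple_measure_def by (rule fp.sigma_finite_measure_axioms)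
  interpret pair_sigma_finite "tuple_measure d" "lborel :: real measure" ..
  have coord: "(\<lambda>x. fst x k) \<in> borel_measurable ?N" if "k < d" for k
  proof -
    have "(\<lambda>v. v k) \<in> measurable (tuple_measure d) lborel"
      unfolding tuple_measure_def using that by (intro measurable_component_singleton) auto
    then have "(\<lambda>v. v k) \<in> borel_measurable (tuple_measure d)" by simp
    then show ?thesis by (rule measurable_compose[OF measurable_fst])
  qed
  have snd [measurable]: "snd \<in> borel_measurable ?N"
    using measurable_snd[of "tuple_measure d" "lborel :: real measure"] by simp
  have d0: "0 < d" using assms by simp
  have coord': "(\<lambda>x. (fst x \<circ> reversal d) k) \<in> borel_measurable ?N" if "k < d" for k
    using coord[of "reversal d k"] by simp
  have [measurable]: "Measurable.pred ?N (\<lambda>x. ccw d (fst x))" "Measurable.pred ?N (\<lambda>x. ccw d (fst x \<circ> reversal d))"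
    "Measurable.pred ?N (\<lambda>x. separated d (fst x) (snd x))" "Measurable.pred ?N (\<lambda>x. separated d (fst x \<circ> reversal d) (snd x))"
    using pred_ccw[where U = fst, OF coord snd d0] pred_separated[where U = fst, OF coord snd d0]
      pred_ccw[where U = "\<lambda>x. fst x \<circ> reversal d", OF coord' snd d0]
      pred_separated[where U = "\<lambda>x. fst x \<circ> reversal d", OF coord' snd d0]
    by simp_all
  have "Measurable.pred ?N (\<lambda>x. Q (fst x) (snd x))"
    unfolding Q_def greaterThanLessThan_iff by measurable
  then have meas: "{x \<in> space ?N. Q (fst x) (snd x)} \<in> sets ?N" by (rule pred_def[THEN iffD1])
  have sep: "AE l in lborel. l \<in> {0<..<1} \<longrightarrow> ccw d u \<longrightarrow> separated d u l" for u
  proof (cases "ccw d u")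
    case True
    then interpret ccw_polygon d u by unfold_locales
    show ?thesis using AE_separated by eventually_elim simp
  qed simp
  have "AE v in tuple_measure d. AE l in lborel. Q (fst (v, l)) (snd (v, l))"
  proof (rule AE_I2)
    fix v
    show "AE l in lborel. Q (fst (v, l)) (snd (v, l))"
      using sep[of v] sep[of "v \<circ> reversal d"] by eventually_elim (simp add: Q_def)
  qed
  then have "AE x in ?N. Q (fst x) (snd x)"
    by (rule AE_pair_measure[OF meas])
  then show ?thesis
  proof eventually_elim
    case (elim x)
    show ?case
    proof (cases x)
      case (Pair v l)
      then show ?thesis
        using elim asymptotically_periodic_if_separated[of v l] by (auto simp: Q_def)
    qed
  qed
qed

end
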